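(* Let $g_1,g_2$ be projectively equivalent, linearly independent (i.e. non-proportional) metrics on a 2-dimensional manifold $M$ that give rise to superintegrable natural Hamiltonians $H_1=g_1^{ij}p_ip_j+V^{(1)}$ and $H_2=g_2^{ij}p_ip_j+V^{(2)}$ with equal projective vector potentials, $U[H_1]=U[H_2]$. Then the family of metrics $$g_t=\frac{\frac{g_1}{\det(g_1)^{2/3}}+t\,\frac{g_2}{\det(g_2)^{2/3}}}{\det\left(\frac{g_1}{\det(g_1)^{2/3}}+t\,\frac{g_2}{\det(g_2)^{2/3}}\right)^2}$$ (with $t\in\mathbb R$, wherever the right-hand side is defined, i.e. the determinant in the denominator is non-zero) gives rise to a family of superintegrable systems with potentials $$V_t=V^{(1)}+t\,V^{(2)},$$ i.e. each Hamiltonian $g_t^{ij}p_ip_j+V_t$ is superintegrable.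
   Context: Two metrics are projectively equivalent if their Levi-Civita connections have the same unparametrized geodesics. All considerations are local and in fixed common coordinates; $\det(g)$ is the determinant of the component matrix, and $\det(g)^{2/3}$ is understood as $|\det g|^{2/3}$. A natural Hamiltonian $H=g^{ij}p_ip_j+V$ on a 2-dimensional manifold is (second-order maximally) superintegrable if there are two further integrals of motion $I^{(\alpha)}=K_{(\alpha)}^{ij}p_ip_j+W^{(\alpha)}$, $\alpha=1,2$, with $W^{(\alpha)}\in C^\infty(M)$, $\{H,I^{(\alpha)}\}=0$ for the canonical Poisson bracket on $T^*M$, such that $H,I^{(1)},I^{(2)}$ are functionally independent. The projective vector potential of $H$ is the weighted vector field $U[H]=|\det(g)|^{2/3}\operatorname{grad}_g(V)$. *)

theory Defs
  imports "HOL-Analysis.Analysis"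
begin

text \<open>Everything takes place in one coordinate chart: the surface \<open>M\<close> is an open subset of \<open>\<real>\<^sup>2\<close>,
  a metric is its matrix of components \<open>g\<^sub>i\<^sub>j\<close>, and the cotangent bundle is \<open>M \<times> \<real>\<^sup>2\<close> with
  canonical coordinates \<open>(x, p)\<close>.\<close>

subsection \<open>Smooth functions\<close>

primrec Ck_on :: "nat \<Rightarrow> 'a::real_normed_vector set \<Rightarrow> ('a \<Rightarrow> 'b::real_normed_vector) \<Rightarrow> bool" where
  "Ck_on 0 S f \<longleftrightarrow> continuous_on S f"
| "Ck_on (Suc k) S f \<longleftrightarrow> (\<forall>x\<in>S. f differentiable (at x)) \<and>
     (\<forall>v. Ck_on k S (\<lambda>x. frechet_derivative f (at x) v))"

text \<open>Intended for open \<open>S\<close> in a finite-dimensional space: the derivatives are taken at \<open>x\<close> in the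
  whole space, and continuity of the derivative is required direction by direction.\<close>

definition smooth_on :: "'a::real_normed_vector set \<Rightarrow> ('a \<Rightarrow> 'b::real_normed_vector) \<Rightarrow> bool" where
  "smooth_on S f \<longleftrightarrow> (\<forall>k. Ck_on k S f)"

definition partial_deriv :: "2 \<Rightarrow> (real^2 \<Rightarrow> real) \<Rightarrow> real^2 \<Rightarrow> real" where
  "partial_deriv i f x = frechet_derivative f (at x) (axis i 1)"

subsection \<open>Metrics, geodesics and projective equivalence\<close>

text \<open>No signature is prescribed, so Riemannian and Lorentzian metrics are both covered.\<close>

definition metric_on :: "(real^2) set \<Rightarrow> (real^2 \<Rightarrow> real^2^2) \<Rightarrow> bool" where
  "metric_on M g \<longleftrightarrow> smooth_on M g \<and> (\<forall>x\<in>M. transpose (g x) = g x \<and> det (g x) \<noteq> 0)"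

definition christoffel :: "(real^2 \<Rightarrow> real^2^2) \<Rightarrow> real^2 \<Rightarrow> 2 \<Rightarrow> 2 \<Rightarrow> 2 \<Rightarrow> real" where
  "christoffel g x k i j = (\<Sum>l\<in>UNIV. matrix_inv (g x) $ k $ l *
     (partial_deriv i (\<lambda>y. g y $ j $ l) x + partial_deriv j (\<lambda>y. g y $ i $ l) x
      - partial_deriv l (\<lambda>y. g y $ i $ j) x)) / 2"

text \<open>Affinely parametrized non-constant geodesics of the Levi-Civita connection, defined on a
  nonempty open interval \<open>J\<close>; \<open>v\<close> is the velocity of \<open>\<gamma>\<close>.\<close>

definition geodesic_on ::
  "(real^2) set \<Rightarrow> (real^2 \<Rightarrow> real^2^2) \<Rightarrow> real set \<Rightarrow> (real \<Rightarrow> real^2) \<Rightarrow> bool" where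
  "geodesic_on M g J \<gamma> \<longleftrightarrow> open J \<and> is_interval J \<and> J \<noteq> {} \<and>
     (\<exists>v. \<forall>s\<in>J. \<gamma> s \<in> M \<and> v s \<noteq> 0 \<and> (\<gamma> has_vector_derivative v s) (at s) \<and>
        (v has_vector_derivative
           (\<chi> k. - (\<Sum>i\<in>UNIV. \<Sum>j\<in>UNIV. christoffel g (\<gamma> s) k i j * v s $ i * v s $ j))) (at s))"

definition reparametrization :: "real set \<Rightarrow> real set \<Rightarrow> (real \<Rightarrow> real) \<Rightarrow> bool" where
  "reparametrization J' J \<phi> \<longleftrightarrow>
     bij_betw \<phi> J' J \<and> smooth_on J' \<phi> \<and> (\<forall>s\<in>J'. deriv \<phi> s \<noteq> 0)"

definition geodesics_reparametrize ::
  "(real^2) set \<Rightarrow> (real^2 \<Rightarrow> real^2^2) \<Rightarrow> (real^2 \<Rightarrow> real^2^2) \<Rightarrow> bool" where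
  "geodesics_reparametrize M g h \<longleftrightarrow>
     (\<forall>J \<gamma>. geodesic_on M g J \<gamma> \<longrightarrow>
        (\<exists>J' \<phi>. reparametrization J' J \<phi> \<and> geodesic_on M h J' (\<gamma> \<circ> \<phi>)))"

definition projectively_equivalent ::
  "(real^2) set \<Rightarrow> (real^2 \<Rightarrow> real^2^2) \<Rightarrow> (real^2 \<Rightarrow> real^2^2) \<Rightarrow> bool" where
  "projectively_equivalent M g h \<longleftrightarrow> geodesics_reparametrize M g h \<and> geodesics_reparametrize M h g"

text \<open>Linear independence over the real constants.\<close>

definition lin_indep_metrics ::
  "(real^2) set \<Rightarrow> (real^2 \<Rightarrow> real^2^2) \<Rightarrow> (real^2 \<Rightarrow> real^2^2) \<Rightarrow> bool" where
  "lin_indep_metrics M g h \<longleftrightarrow>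
     (\<forall>a b::real. (\<forall>x\<in>M. a *\<^sub>R g x + b *\<^sub>R h x = 0) \<longrightarrow> a = 0 \<and> b = 0)"

subsection \<open>Superintegrable natural Hamiltonians\<close>

definition quad_plus_pot ::
  "(real^2 \<Rightarrow> real^2^2) \<Rightarrow> (real^2 \<Rightarrow> real) \<Rightarrow> (real^2) \<times> (real^2) \<Rightarrow> real" where
  "quad_plus_pot K W = (\<lambda>(x, p). (\<Sum>i\<in>UNIV. \<Sum>j\<in>UNIV. K x $ i $ j * p $ i * p $ j) + W x)"

definition natural_hamiltonian ::
  "(real^2 \<Rightarrow> real^2^2) \<Rightarrow> (real^2 \<Rightarrow> real) \<Rightarrow> (real^2) \<times> (real^2) \<Rightarrow> real" where
  "natural_hamiltonian g V = quad_plus_pot (\<lambda>x. matrix_inv (g x)) V"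

definition poisson_bracket ::
  "((real^2) \<times> (real^2) \<Rightarrow> real) \<Rightarrow> ((real^2) \<times> (real^2) \<Rightarrow> real) \<Rightarrow> (real^2) \<times> (real^2) \<Rightarrow> real" where
  "poisson_bracket F G z =
     (\<Sum>i\<in>UNIV. frechet_derivative F (at z) (axis i 1, 0) * frechet_derivative G (at z) (0, axis i 1)
             - frechet_derivative F (at z) (0, axis i 1) * frechet_derivative G (at z) (axis i 1, 0))"

definition quadratic_integral ::
  "(real^2) set \<Rightarrow> ((real^2) \<times> (real^2) \<Rightarrow> real) \<Rightarrow> (real^2 \<Rightarrow> real^2^2) \<Rightarrow> (real^2 \<Rightarrow> real) \<Rightarrow> bool" where
  "quadratic_integral M H K W \<longleftrightarrow>
     smooth_on M K \<and> (\<forall>x\<in>M. transpose (K x) = K x) \<and> smooth_on M W \<and>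
     (\<forall>z \<in> M \<times> UNIV. poisson_bracket H (quad_plus_pot K W) z = 0)"

definition differentials_indep_at ::
  "('a::real_normed_vector \<Rightarrow> real) \<Rightarrow> ('a \<Rightarrow> real) \<Rightarrow> ('a \<Rightarrow> real) \<Rightarrow> 'a \<Rightarrow> bool" where
  "differentials_indep_at F G H z \<longleftrightarrow>
     (\<forall>a b c. (\<forall>v. a * frechet_derivative F (at z) v + b * frechet_derivative G (at z) v
                   + c * frechet_derivative H (at z) v = 0) \<longrightarrow> a = 0 \<and> b = 0 \<and> c = 0)"

text \<open>Functional independence is independence of the differentials on a dense subset (for smooth
  functions automatically open). It cannot be asked at every point: on the zero section the
  differentials of functions quadratic in \<open>p\<close> have no \<open>dp\<close> part, so no three are independent.\<close>

definition functionally_independent_on ::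
  "'a::real_normed_vector set \<Rightarrow> ('a \<Rightarrow> real) \<Rightarrow> ('a \<Rightarrow> real) \<Rightarrow> ('a \<Rightarrow> real) \<Rightarrow> bool" where
  "functionally_independent_on S F G H \<longleftrightarrow> S \<subseteq> closure {z\<in>S. differentials_indep_at F G H z}"

definition superintegrable ::
  "(real^2) set \<Rightarrow> (real^2 \<Rightarrow> real^2^2) \<Rightarrow> (real^2 \<Rightarrow> real) \<Rightarrow> bool" where
  "superintegrable M g V \<longleftrightarrow> metric_on M g \<and> smooth_on M V \<and>
     (\<exists>K\<^sub>1 W\<^sub>1 K\<^sub>2 W\<^sub>2.
        quadratic_integral M (natural_hamiltonian g V) K\<^sub>1 W\<^sub>1 \<and>
        quadratic_integral M (natural_hamiltonian g V) K\<^sub>2 W\<^sub>2 \<and>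
        functionally_independent_on (M \<times> UNIV)
          (natural_hamiltonian g V) (quad_plus_pot K\<^sub>1 W\<^sub>1) (quad_plus_pot K\<^sub>2 W\<^sub>2))"

subsection \<open>Projective vector potential and the family of metrics\<close>

definition gradient :: "(real^2 \<Rightarrow> real^2^2) \<Rightarrow> (real^2 \<Rightarrow> real) \<Rightarrow> real^2 \<Rightarrow> real^2" where
  "gradient g V x = matrix_inv (g x) *v (\<chi> i. partial_deriv i V x)"

definition proj_vector_potential ::
  "(real^2 \<Rightarrow> real^2^2) \<Rightarrow> (real^2 \<Rightarrow> real) \<Rightarrow> real^2 \<Rightarrow> real^2" where
  "proj_vector_potential g V x = (\<bar>det (g x)\<bar> powr (2/3)) *\<^sub>R gradient g V x"

definition weighted_pencil ::
  "(real^2 \<Rightarrow> real^2^2) \<Rightarrow> (real^2 \<Rightarrow> real^2^2) \<Rightarrow> real \<Rightarrow> real^2 \<Rightarrow> real^2^2" where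
  "weighted_pencil g h t x =
     g x /\<^sub>R (\<bar>det (g x)\<bar> powr (2/3)) + t *\<^sub>R (h x /\<^sub>R (\<bar>det (h x)\<bar> powr (2/3)))"

definition metric_family ::
  "(real^2 \<Rightarrow> real^2^2) \<Rightarrow> (real^2 \<Rightarrow> real^2^2) \<Rightarrow> real \<Rightarrow> real^2 \<Rightarrow> real^2^2" where
  "metric_family g h t x = weighted_pencil g h t x /\<^sub>R (det (weighted_pencil g h t x))\<^sup>2"

end

theory Submission
  imports Defs
begin

text \<open>Write \<open>\<psi> = g / |det g|\<^bsup>2/3\<^esup>\<close>, so that \<open>g = \<psi> / (det \<psi>)\<^sup>2\<close> and \<open>g\<^sup>-\<^sup>1 = det \<psi> \<cdot> adj \<psi>\<close>,
  substitute \<open>q = adj \<psi> p\<close> in the fibres and write a quadratic form \<open>K\<^sup>i\<^sup>j p\<^sub>i p\<^sub>j\<close> as \<open>\<kappa>\<^sub>i\<^sub>j q\<^sup>i q\<^sup>j\<close>.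
  Then \<open>\<kappa>\<^sub>i\<^sub>j q\<^sup>i q\<^sup>j + W\<close> is an integral of \<open>g\<^sup>i\<^sup>j p\<^sub>i p\<^sub>j + V\<close> iff \<open>\<kappa>\<close> and \<open>W\<close> satisfy linear equations
  whose coefficients are only the projective connection of \<open>g\<close> (its Thomas symbol \<open>\<Pi>\<close>) and the projective
  vector potential \<open>U\<close>; the pair \<open>(\<psi>, V)\<close> itself is a solution. Hence \<open>g\<^sub>1\<close>, \<open>g\<^sub>2\<close> and all members of the
  pencil \<open>\<psi>\<^sub>1 + t \<psi>\<^sub>2\<close> have the same integrals. That projectively equivalent metrics share \<open>\<Pi>\<close> needs a geodesic
  through every tangent vector, which is Picard's theorem.

  Functional independence of \<open>(\<psi>\<^sub>1, \<kappa>\<^sub>1, \<kappa>\<^sub>2)\<close> does not give that of \<open>(\<psi>\<^sub>1 + t \<psi>\<^sub>2, \<kappa>\<^sub>1, \<kappa>\<^sub>2)\<close>. Replacing the last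
  two by \<open>\<kappa>\<^sub>1 - s \<psi>\<^sub>1\<close> and \<open>\<kappa>\<^sub>2 - s\<^sup>2 \<psi>\<^sub>1\<close>, at each point only finitely many \<open>s\<close> are bad, so some \<open>s\<close> is good
  on a countable dense set.\<close>

section \<open>Smooth functions\<close>

lemma Ck_on_cong:
  assumes "open S" "\<And>x. x \<in> S \<Longrightarrow> f x = g x" "Ck_on k S f"
  shows "Ck_on k S g"
  using assms(2,3)
proof (induction k arbitrary: f g)
  case 0
  then show ?case by (simp cong: continuous_on_cong)
next
  case (Suc k)
  have fr: "frechet_derivative f (at x) = frechet_derivative g (at x)" if "x \<in> S" for x
    using Suc.prems that assms(1)
    by (intro frechet_derivative_transform_within_open[where X = S]) auto
  have "g differentiable (at x)" if "x \<in> S" for x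
    using Suc.prems that assms(1)
    unfolding differentiable_def Ck_on.simps
    using has_derivative_transform_within_open[OF _ assms(1) that] Suc.prems(1) by metis
  moreover have "Ck_on k S (\<lambda>x. frechet_derivative g (at x) v)" for v
    by (rule Suc.IH[where f = "\<lambda>x. frechet_derivative f (at x) v"])
      (use Suc.prems(2) fr in simp_all)
  ultimately show ?case by simp
qed

text \<open>\<open>frechet_derivative\<close> is a choice operator, so its unfolding gives no
  formula to compute with. This rule lets any explicit derivative stand in for it, which reduces
  most closure properties below to an induction on the order.\<close>

lemma Ck_on_SucI:
  assumes "open S" "\<And>x. x \<in> S \<Longrightarrow> (f has_derivative f' x) (at x)"
    and "\<And>v. Ck_on k S (\<lambda>x. f' x v)"
  shows "Ck_on (Suc k) S f"
proof -
  have "f' x v = frechet_derivative f (at x) v" if "x \<in> S" for x v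
    by (simp only: frechet_derivative_at[OF assms(2)[OF that], symmetric])
  note f' = this
  have "Ck_on k S (\<lambda>x. frechet_derivative f (at x) v)" for v
    by (rule Ck_on_cong[OF assms(1) f' assms(3)[of v]])
  then show ?thesis using assms(2) by (auto simp: differentiable_def)
qed

lemma Ck_on_SucD: "Ck_on (Suc k) S f \<Longrightarrow> Ck_on k S f"
proof (induction k arbitrary: f)
  case 0
  then show ?case
    by (auto intro!: continuous_at_imp_continuous_on differentiable_imp_continuous_within)
next
  case (Suc k)
  then show ?case by simp
qed

lemma Ck_on_const: "Ck_on k S (\<lambda>x. c)"
proof (induction k arbitrary: c)
  case (Suc k)
  then show ?case by simp
qed simp

lemma Ck_on_has_derivative:
  "Ck_on (Suc k) S f \<Longrightarrow> x \<in> S \<Longrightarrow> (f has_derivative frechet_derivative f (at x)) (at x)"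
  by (simp add: frechet_derivative_works)

lemma Ck_on_bounded_linear:
  assumes "open S" "bounded_linear L" "Ck_on k S f"
  shows "Ck_on k S (\<lambda>x. L (f x))"
  using assms(3)
proof (induction k arbitrary: f)
  case 0
  then show ?case using bounded_linear.continuous_on[OF assms(2)] by simp
next
  case (Suc k)
  show ?case
    by (rule Ck_on_SucI[OF assms(1) bounded_linear.has_derivative[OF assms(2)
          Ck_on_has_derivative[OF Suc.prems]]])
       (use Suc in auto)
qed

lemma Ck_on_add:
  assumes "open S" "Ck_on k S f" "Ck_on k S g"
  shows "Ck_on k S (\<lambda>x. f x + g x)"
  using assms(2,3)
proof (induction k arbitrary: f g)
  case 0
  then show ?case by (simp add: continuous_on_add)
next
  case (Suc k)
  show ?case
    by (rule Ck_on_SucI[OF assms(1) has_derivative_add[OF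
          Ck_on_has_derivative[OF Suc.prems(1)] Ck_on_has_derivative[OF Suc.prems(2)]]])
       (use Suc in auto)
qed

lemma Ck_on_mult:
  fixes f g :: "'a::real_normed_vector \<Rightarrow> real"
  assumes "open S" "Ck_on k S f" "Ck_on k S g"
  shows "Ck_on k S (\<lambda>x. f x * g x)"
  using assms(2,3)
proof (induction k arbitrary: f g)
  case 0
  then show ?case by (simp add: continuous_on_mult)
next
  case (Suc k)
  have *: "Ck_on k S f" "Ck_on k S g" using Suc.prems Ck_on_SucD by auto
  show ?case
    by (rule Ck_on_SucI[OF assms(1) has_derivative_mult[OF
          Ck_on_has_derivative[OF Suc.prems(1)] Ck_on_has_derivative[OF Suc.prems(2)]]])
       (use Suc * in \<open>auto intro!: Ck_on_add[OF assms(1)] Suc.IH\<close>)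
qed

lemma Ck_on_uminus:
  assumes "open S" "Ck_on k S f"
  shows "Ck_on k S (\<lambda>x. - f x)"
  using Ck_on_bounded_linear[OF assms(1) bounded_linear_minus[OF bounded_linear_ident] assms(2)] .

text \<open>The derivative of 1/f is built from f' and 1/f alone, so the induction on k feeds 1/f at
  order k back into its own derivative.\<close>

lemma Ck_on_inverse:
  fixes f :: "'a::real_normed_vector \<Rightarrow> real"
  assumes "open S" "Ck_on k S f" "\<And>x. x \<in> S \<Longrightarrow> f x \<noteq> 0"
  shows "Ck_on k S (\<lambda>x. inverse (f x))"
  using assms(2)
proof (induction k)
  case 0
  then show ?case using assms(3) by (auto intro: continuous_on_inverse)
next
  case (Suc k)
  have *: "Ck_on k S (\<lambda>x. inverse (f x))" using Suc Ck_on_SucD by blast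
  show ?case
    by (rule Ck_on_SucI[OF assms(1) Deriv.has_derivative_inverse[OF assms(3)
          Ck_on_has_derivative[OF Suc.prems]]])
       (use Suc.prems * in \<open>auto intro!: Ck_on_mult[OF assms(1)] Ck_on_uminus[OF assms(1)]\<close>)
qed

text \<open>The derivative is written as a times the same power times f'/f, not with exponent a - 1.
  The power reappears with unchanged exponent, so the induction in \<open>Ck_on_abs_powr\<close>
  runs for a fixed a.\<close>

lemma has_derivative_abs_powr:
  fixes f :: "'a::real_normed_vector \<Rightarrow> real"
  assumes "(f has_derivative f') (at x)" "f x \<noteq> 0"
  shows "((\<lambda>x. \<bar>f x\<bar> powr a) has_derivative
    (\<lambda>v. a * (\<bar>f x\<bar> powr a * (f' v * inverse (f x))))) (at x)"
proof -
  have abs: "((\<lambda>x. \<bar>f x\<bar>) has_derivative (\<lambda>v. f' v * sgn (f x))) (at x)"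
    using has_derivative_compose[OF assms(1) has_derivative_norm[OF assms(2)]]
    by (simp add: inner_real_def mult.commute)
  have "((\<lambda>x. \<bar>f x\<bar> powr a) has_derivative (\<lambda>v. \<bar>f x\<bar> powr a *
      (0 * ln \<bar>f x\<bar> + f' v * sgn (f x) * a / \<bar>f x\<bar>))) (at x)"
    by (rule has_derivative_powr[OF abs has_derivative_const]) (use assms(2) in auto)
  moreover have "sgn (f x) * a / \<bar>f x\<bar> = a * inverse (f x)"
    by (simp add: sgn_if abs_if divide_inverse)
  ultimately show ?thesis
    by (simp only: times_divide_eq_right[symmetric] mult.assoc mult_zero_left add_0_left)
       (simp only: mult.left_commute[of a])
qed

lemma Ck_on_abs_powr:
  fixes f :: "'a::real_normed_vector \<Rightarrow> real"
  assumes "open S" "Ck_on k S f" "\<And>x. x \<in> S \<Longrightarrow> f x \<noteq> 0"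
  shows "Ck_on k S (\<lambda>x. \<bar>f x\<bar> powr a)"
  using assms(2)
proof (induction k)
  case 0
  then show ?case using assms(3)
    by (simp add: continuous_on_powr continuous_on_rabs)
next
  case (Suc k)
  have *: "Ck_on k S (\<lambda>x. \<bar>f x\<bar> powr a)" "Ck_on k S (\<lambda>x. inverse (f x))"
    using Suc.IH[OF Ck_on_SucD[OF Suc.prems]]
      Ck_on_inverse[OF assms(1) Ck_on_SucD[OF Suc.prems] assms(3)] by simp_all
  show ?case
    by (rule Ck_on_SucI[OF assms(1) has_derivative_abs_powr[OF
          Ck_on_has_derivative[OF Suc.prems] assms(3)]])
       (use Suc.prems * in \<open>auto intro!: Ck_on_mult[OF assms(1)] Ck_on_const\<close>)
qed

section \<open>Closure rules for infinitely differentiable functions\<close>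

lemma smooth_on_cong:
  "open S \<Longrightarrow> (\<And>x. x \<in> S \<Longrightarrow> f x = g x) \<Longrightarrow> smooth_on S f \<Longrightarrow> smooth_on S g"
  unfolding smooth_on_def by (metis Ck_on_cong)

lemma smooth_on_const: "smooth_on S (\<lambda>x. c)"
  by (simp add: smooth_on_def Ck_on_const)

lemma smooth_on_bounded_linear:
  "open S \<Longrightarrow> bounded_linear L \<Longrightarrow> smooth_on S f \<Longrightarrow> smooth_on S (\<lambda>x. L (f x))"
  by (simp add: smooth_on_def Ck_on_bounded_linear)

lemma smooth_on_add:
  "open S \<Longrightarrow> smooth_on S f \<Longrightarrow> smooth_on S g \<Longrightarrow> smooth_on S (\<lambda>x. f x + g x)"
  by (simp add: smooth_on_def Ck_on_add)

lemma smooth_on_uminus: "open S \<Longrightarrow> smooth_on S f \<Longrightarrow> smooth_on S (\<lambda>x. - f x)"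
  by (simp add: smooth_on_def Ck_on_uminus)

lemma smooth_on_diff:
  "open S \<Longrightarrow> smooth_on S f \<Longrightarrow> smooth_on S g \<Longrightarrow> smooth_on S (\<lambda>x. f x - g x)"
  using smooth_on_add[of S f "\<lambda>x. - g x"] smooth_on_uminus[of S g] by simp

lemma smooth_on_mult:
  fixes f g :: "'a::real_normed_vector \<Rightarrow> real"
  shows "open S \<Longrightarrow> smooth_on S f \<Longrightarrow> smooth_on S g \<Longrightarrow> smooth_on S (\<lambda>x. f x * g x)"
  by (simp add: smooth_on_def Ck_on_mult)

lemma smooth_on_inverse:
  fixes f :: "'a::real_normed_vector \<Rightarrow> real"
  shows "open S \<Longrightarrow> smooth_on S f \<Longrightarrow> (\<And>x. x \<in> S \<Longrightarrow> f x \<noteq> 0) \<Longrightarrow> smooth_on S (\<lambda>x. inverse (f x))"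
  by (simp add: smooth_on_def Ck_on_inverse)

lemma smooth_on_divide:
  fixes f g :: "'a::real_normed_vector \<Rightarrow> real"
  shows "open S \<Longrightarrow> smooth_on S f \<Longrightarrow> smooth_on S g \<Longrightarrow> (\<And>x. x \<in> S \<Longrightarrow> g x \<noteq> 0)
    \<Longrightarrow> smooth_on S (\<lambda>x. f x / g x)"
  unfolding divide_inverse by (intro smooth_on_mult smooth_on_inverse)

lemma smooth_on_power:
  fixes f :: "'a::real_normed_vector \<Rightarrow> real"
  shows "open S \<Longrightarrow> smooth_on S f \<Longrightarrow> smooth_on S (\<lambda>x. f x ^ n)"
  by (induction n) (simp_all add: smooth_on_const smooth_on_mult)

lemma smooth_on_abs_powr:
  fixes f :: "'a::real_normed_vector \<Rightarrow> real"
  shows "open S \<Longrightarrow> smooth_on S f \<Longrightarrow> (\<And>x. x \<in> S \<Longrightarrow> f x \<noteq> 0)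
    \<Longrightarrow> smooth_on S (\<lambda>x. \<bar>f x\<bar> powr a)"
  by (simp add: smooth_on_def Ck_on_abs_powr)

lemmas smooth_on_intros = smooth_on_const smooth_on_add smooth_on_uminus smooth_on_diff
  smooth_on_mult smooth_on_divide smooth_on_power smooth_on_abs_powr

lemma Ck_on_subset: "Ck_on k S f \<Longrightarrow> T \<subseteq> S \<Longrightarrow> Ck_on k T f"
  by (induction k arbitrary: f) (auto intro: continuous_on_subset)

lemma smooth_on_subset: "smooth_on S f \<Longrightarrow> T \<subseteq> S \<Longrightarrow> smooth_on T f"
  unfolding smooth_on_def by (metis Ck_on_subset)

lemma smooth_on_differentiable: "smooth_on S f \<Longrightarrow> x \<in> S \<Longrightarrow> f differentiable (at x)"
  unfolding smooth_on_def by (metis Ck_on.simps(2))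

lemma smooth_on_has_derivative:
  "smooth_on S f \<Longrightarrow> x \<in> S \<Longrightarrow> (f has_derivative frechet_derivative f (at x)) (at x)"
  using smooth_on_differentiable frechet_derivative_works by blast

lemma smooth_on_continuous_on: "smooth_on S f \<Longrightarrow> continuous_on S f"
  unfolding smooth_on_def by (metis Ck_on.simps(1))

lemma smooth_on_frechet_derivative:
  "smooth_on S f \<Longrightarrow> smooth_on S (\<lambda>x. frechet_derivative f (at x) v)"
  unfolding smooth_on_def by (metis Ck_on.simps(2))

lemma smooth_on_partial_deriv: "smooth_on S f \<Longrightarrow> smooth_on S (partial_deriv i f)"
  using smooth_on_frechet_derivative unfolding partial_deriv_def[abs_def] .

lemma smooth_on_nth:
  "open S \<Longrightarrow> smooth_on S f \<Longrightarrow> smooth_on S (\<lambda>x. f x $ i)"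
  by (rule smooth_on_bounded_linear[OF _ bounded_linear_vec_nth])

lemma smooth_on_scaleR_const:
  "open S \<Longrightarrow> smooth_on S f \<Longrightarrow> smooth_on S (\<lambda>x. f x *\<^sub>R c)"
  by (rule smooth_on_bounded_linear[OF _ bounded_linear_scaleR_left])

lemma smooth_on_matrixI:
  fixes f :: "'a::real_normed_vector \<Rightarrow> real^2^2"
  assumes "open S" "\<And>i j. smooth_on S (\<lambda>x. f x $ i $ j)"
  shows "smooth_on S f"
proof -
  have "f = (\<lambda>x. f x $ 1 $ 1 *\<^sub>R axis 1 (axis 1 1) + f x $ 1 $ 2 *\<^sub>R axis 1 (axis 2 1)
      + f x $ 2 $ 1 *\<^sub>R axis 2 (axis 1 1) + f x $ 2 $ 2 *\<^sub>R axis 2 (axis 2 1))"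
    by (auto simp: fun_eq_iff vec_eq_iff forall_2 axis_def)
  moreover have "smooth_on S \<dots>"
    by (intro smooth_on_add smooth_on_scaleR_const assms)
  ultimately show ?thesis by simp
qed

section \<open>Local solutions of ordinary differential equations\<close>

text \<open>The difference of two integrals from the left endpoint is the signed integral from 0 to
  a for either sign of a, whereas \<open>integral {0..a} g\<close> would be 0 for negative
  a.\<close>

lemma norm_signed_integral_le:
  fixes g :: "real \<Rightarrow> 'a::banach"
  assumes "continuous_on {-h..h} g" "0 \<le> h" "a \<in> {-h..h}"
    and B: "\<And>t. t \<in> {-h..h} \<Longrightarrow> norm (g t) \<le> B"
  shows "norm (integral {-h..a} g - integral {-h..0} g) \<le> B * h"
proof -
  have B0: "0 \<le> B" using B[of 0] assms(2) by (smt (verit) atLeastAtMost_iff norm_ge_zero)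
  have int: "g integrable_on {-h..c}" if "c \<le> h" for c
    using assms(1) that by (intro integrable_continuous_real) (auto elim: continuous_on_subset)
  show ?thesis
  proof (cases "0 \<le> a")
    case True
    have "integral {-h..0} g + integral {0..a} g = integral {-h..a} g"
      using assms True by (intro Henstock_Kurzweil_Integration.integral_combine int) auto
    moreover have "norm (integral {0..a} g) \<le> B * (a - 0)"
      using assms True by (intro integral_bound) (auto elim: continuous_on_subset)
    moreover have "B * a \<le> B * h" using assms B0 by (simp add: mult_left_mono)
    ultimately show ?thesis by (smt (verit) add_diff_cancel_left')
  next
    case False
    have "integral {-h..a} g + integral {a..0} g = integral {-h..0} g"
      using assms False by (intro Henstock_Kurzweil_Integration.integral_combine int) auto
    moreover have "norm (integral {a..0} g) \<le> B * (0 - a)"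
      using assms False by (intro integral_bound) (auto elim: continuous_on_subset)
    moreover have "B * (0 - a) \<le> B * h" using assms B0 by (intro mult_left_mono) auto
    ultimately show ?thesis by (smt (verit) add_diff_cancel_left' norm_minus_commute)
  qed
qed

text \<open>Picard iteration in the complete space of bounded continuous functions on the line. The
  bound B keeps the iterates bounded, and the iteration map contracts with factor L h < 1.\<close>

lemma global_lipschitz_local_solution:
  fixes F :: "'a::banach \<Rightarrow> 'a"
  assumes lip: "\<And>x y. norm (F x - F y) \<le> L * norm (x - y)"
    and bd: "\<And>x. norm (F x) \<le> B"
    and "0 \<le> L" and h: "0 < h" "L * h < 1"
  obtains y where "y 0 = y0"
    and "\<And>t. norm (y t - y0) \<le> B * h"
    and "\<And>t. t \<in> {-h<..<h} \<Longrightarrow> (y has_vector_derivative F (y t)) (at t)"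
proof -
  have contF: "continuous_on UNIV F"
    by (rule lipschitz_on_continuous_on[of L], rule lipschitz_onI)
       (use lip \<open>0 \<le> L\<close> in \<open>auto simp: dist_norm\<close>)
  \<comment> \<open>Freezing time outside [-h, h] makes the Picard operator act on functions defined
    on all of the reals, so the contraction principle for the type of bounded continuous functions
    applies.\<close>
  define c where "c t = max (-h) (min h t)" for t :: real
  have c: "c t \<in> {-h..h}" for t using h(1) by (auto simp: c_def)
  have cid: "c t = t" if "t \<in> {-h..h}" for t using that by (auto simp: c_def)
  have contc: "continuous_on A c" for A unfolding c_def by (intro continuous_intros)
  define J where "J g t = y0 + (integral {-h..c t} g - integral {-h..0} g)" for g :: "real \<Rightarrow> 'a" and t
  have contFy: "continuous_on A (\<lambda>t. F (apply_bcontfun u t))" for A and u :: "real \<Rightarrow>\<^sub>C 'a"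
    by (rule continuous_on_compose2[OF contF]) auto
  have J: "J (\<lambda>t. F (apply_bcontfun u t)) \<in> bcontfun" for u :: "real \<Rightarrow>\<^sub>C 'a"
  proof (rule bcontfun_normI)
    have "continuous_on {-h..h} (\<lambda>t. integral {-h..t} (\<lambda>t. F (apply_bcontfun u t)))"
      by (intro indefinite_integral_continuous_1 integrable_continuous_real contFy)
    then have "continuous_on UNIV (\<lambda>t. integral {-h..c t} (\<lambda>t. F (apply_bcontfun u t)))"
      by (rule continuous_on_compose2[OF _ contc]) (use c in auto)
    then show "continuous_on UNIV (J (\<lambda>t. F (apply_bcontfun u t)))"
      unfolding J_def[abs_def] by (intro continuous_intros)
    show "norm (J (\<lambda>t. F (apply_bcontfun u t)) t) \<le> norm y0 + B * h" for t
      unfolding J_def using h(1) c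
      by (intro order_trans[OF norm_triangle_ineq] add_left_mono norm_signed_integral_le contFy bd) auto
  qed
  define T where "T u = Bcontfun (J (\<lambda>t. F (apply_bcontfun u t)))" for u :: "real \<Rightarrow>\<^sub>C 'a"
  have T: "apply_bcontfun (T u) = J (\<lambda>t. F (apply_bcontfun u t))" for u
    unfolding T_def by (rule Bcontfun_inverse[OF J])
  have "dist (T u) (T v) \<le> (L * h) * dist u v" for u v
  proof (rule dist_bound)
    fix t
    have int: "(\<lambda>t. F (apply_bcontfun u t)) integrable_on {-h..a}" for u :: "real \<Rightarrow>\<^sub>C 'a" and a
      by (intro integrable_continuous_real contFy)
    have "apply_bcontfun (T u) t - apply_bcontfun (T v) t =
        integral {-h..c t} (\<lambda>t. F (apply_bcontfun u t) - F (apply_bcontfun v t))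
        - integral {-h..0} (\<lambda>t. F (apply_bcontfun u t) - F (apply_bcontfun v t))"
      by (simp add: T J_def Henstock_Kurzweil_Integration.integral_diff int)
    moreover have "norm \<dots> \<le> (L * dist u v) * h"
    proof (rule norm_signed_integral_le)
      fix t
      have "norm (F (apply_bcontfun u t) - F (apply_bcontfun v t))
          \<le> L * dist (apply_bcontfun u t) (apply_bcontfun v t)"
        using lip by (simp add: dist_norm)
      also have "\<dots> \<le> L * dist u v"
        by (intro mult_left_mono dist_bounded \<open>0 \<le> L\<close>)
      finally show "norm (F (apply_bcontfun u t) - F (apply_bcontfun v t)) \<le> L * dist u v" .
    qed (use c h(1) in \<open>auto intro!: continuous_on_diff contFy\<close>)
    ultimately show "dist (apply_bcontfun (T u) t) (apply_bcontfun (T v) t) \<le> L * h * dist u v"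
      by (simp add: dist_norm ac_simps)
  qed
  then obtain u where u: "T u = u"
    using banach_fix_type[of "L * h" T] \<open>0 \<le> L\<close> h by auto
  let ?y = "apply_bcontfun u"
  have y: "?y t = J (\<lambda>t. F (?y t)) t" for t using T[of u] u by simp
  show thesis
  proof (rule that[of ?y])
    show "?y 0 = y0" using h(1) by (subst y) (simp add: J_def cid)
    show "norm (?y t - y0) \<le> B * h" for t
      unfolding y[of t] J_def add_diff_cancel_left'
      using h(1) c by (intro norm_signed_integral_le contFy bd) auto
    fix t assume t: "t \<in> {-h<..<h}"
    have "((\<lambda>s. integral {-h..s} (\<lambda>t. F (?y t))) has_vector_derivative F (?y t)) (at t within {-h..h})"
      using t by (intro integral_has_vector_derivative contFy) auto
    then have "((\<lambda>s. integral {-h..s} (\<lambda>t. F (?y t))) has_vector_derivative F (?y t)) (at t)"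
      using t by (simp add: at_within_Icc_at)
    then have "((\<lambda>s. y0 + (integral {-h..s} (\<lambda>t. F (?y t)) - integral {-h..0} (\<lambda>t. F (?y t))))
        has_vector_derivative F (?y t)) (at t)"
      by (auto intro!: derivative_eq_intros)
    moreover have "y0 + (integral {-h..s} (\<lambda>t. F (?y t)) - integral {-h..0} (\<lambda>t. F (?y t))) = ?y s"
      if "s \<in> {-h<..<h}" for s
      using y[of s] cid[of s] that by (simp add: J_def)
    ultimately show "(?y has_vector_derivative F (?y t)) (at t)"
      by (rule has_vector_derivative_transform_within_open[OF _ open_greaterThanLessThan t])
  qed
qed

text \<open>Smoothness controls the derivative direction by direction only. The operator norm is at
  most the sum of the norms over a basis, which is continuous and hence bounded on the compact ball;
  convexity turns this bound into a Lipschitz constant.\<close>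

lemma smooth_on_lipschitz_cball:
  fixes f :: "'a::euclidean_space \<Rightarrow> 'b::real_normed_vector"
  assumes "smooth_on S f" "cball x0 r \<subseteq> S"
  obtains L where "0 \<le> L" "\<And>x y. x \<in> cball x0 r \<Longrightarrow> y \<in> cball x0 r \<Longrightarrow> norm (f x - f y) \<le> L * norm (x - y)"
proof -
  have der: "(f has_derivative frechet_derivative f (at x)) (at x)" if "x \<in> cball x0 r" for x
    using smooth_on_has_derivative[OF assms(1)] assms(2) that by blast
  have "continuous_on (cball x0 r) (\<lambda>x. \<Sum>b\<in>Basis. norm (frechet_derivative f (at x) b))"
    using continuous_on_subset[OF smooth_on_continuous_on[OF smooth_on_frechet_derivative[OF assms(1)]] assms(2)]
    by (intro continuous_intros)
  then have "bounded ((\<lambda>x. \<Sum>b\<in>Basis. norm (frechet_derivative f (at x) b)) ` cball x0 r)"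
    by (intro compact_imp_bounded compact_continuous_image compact_cball)
  then obtain L where L: "\<forall>x\<in>cball x0 r. (\<Sum>b\<in>Basis. norm (frechet_derivative f (at x) b)) \<le> L"
    "0 < L"
    unfolding bounded_pos by (auto simp: sum_nonneg simp del: mem_cball)
  show thesis
  proof (rule that[of L])
    fix x y assume xy: "x \<in> cball x0 r" "y \<in> cball x0 r"
    show "norm (f x - f y) \<le> L * norm (x - y)"
    proof (rule differentiable_bound[OF convex_cball _ _ xy])
      show "(f has_derivative frechet_derivative f (at z)) (at z within cball x0 r)"
        if "z \<in> cball x0 r" for z using der[OF that] by (rule has_derivative_at_withinI)
      show "onorm (frechet_derivative f (at z)) \<le> L" if "z \<in> cball x0 r" for z
        using onorm_componentwise[OF has_derivative_bounded_linear[OF der[OF that]]] L(1) that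
        by fastforce
    qed
  qed (use L in simp)
qed

theorem smooth_ode_local_solution:
  fixes f :: "'a::euclidean_space \<Rightarrow> 'a"
  assumes "open S" "smooth_on S f" "y0 \<in> S"
  obtains h y where "0 < h" "y 0 = y0"
    and "\<And>t. t \<in> {-h<..<h} \<Longrightarrow> y t \<in> S \<and> (y has_vector_derivative f (y t)) (at t)"
proof -
  obtain r where r: "0 < r" "cball y0 r \<subseteq> S"
    using assms open_contains_cball by blast
  obtain L where L: "0 \<le> L"
    "\<And>x y. x \<in> cball y0 r \<Longrightarrow> y \<in> cball y0 r \<Longrightarrow> norm (f x - f y) \<le> L * norm (x - y)"
    using smooth_on_lipschitz_cball[OF assms(2) r(2)] by metis
  \<comment> \<open>Retracting to the ball makes the right-hand side globally Lipschitz and bounded.\<close>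
  define F where "F x = f (closest_point (cball y0 r) x)" for x
  have cp: "closest_point (cball y0 r) x \<in> cball y0 r" for x
    using r(1) by (intro closest_point_in_set) auto
  have lip: "norm (F x - F y) \<le> L * norm (x - y)" for x y
  proof -
    have "norm (F x - F y) \<le> L * norm (closest_point (cball y0 r) x - closest_point (cball y0 r) y)"
      unfolding F_def by (rule L(2)[OF cp cp])
    also have "\<dots> \<le> L * norm (x - y)"
      using closest_point_lipschitz[of "cball y0 r" x y] r(1) L(1)
      by (intro mult_left_mono) (auto simp: dist_norm)
    finally show ?thesis .
  qed
  define B where "B = norm (f y0) + L * r"
  have bd: "norm (F x) \<le> B" for x
  proof -
    have "norm (F x) \<le> norm (f y0) + norm (F x - f y0)"
      by (metis add.commute diff_add_cancel norm_triangle_ineq)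
    also have "norm (F x - f y0) \<le> L * norm (closest_point (cball y0 r) x - y0)"
      unfolding F_def using r(1) by (intro L(2)[OF cp]) auto
    also have "\<dots> \<le> L * r"
      using cp[of x] L(1) by (intro mult_left_mono) (auto simp: dist_norm norm_minus_commute)
    finally show ?thesis by (simp add: B_def)
  qed
  have B0: "0 \<le> B" using L(1) r(1) by (simp add: B_def)
  \<comment> \<open>The first bound gives B h \<le> r, so the solution never leaves the ball, where
    the retraction is the identity; the second gives L h < 1. Adding 1 keeps the denominators
    positive.\<close>
  define h where "h = min (r / (B + 1)) (1 / (L + 1))"
  have h: "0 < h" using r(1) B0 L(1) by (simp add: h_def)
  have "L * h \<le> L * (1 / (L + 1))" using L(1) by (intro mult_left_mono) (auto simp: h_def)
  also have "\<dots> < 1" using L(1) by (simp add: divide_simps)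
  finally have Lh: "L * h < 1" .
  have "B * h \<le> B * (r / (B + 1))" using B0 by (intro mult_left_mono) (auto simp: h_def)
  also have "\<dots> \<le> r" using B0 r(1) by (simp add: divide_simps algebra_simps)
  finally have Bh: "B * h \<le> r" .
  obtain y where y: "y 0 = y0" "\<And>t. norm (y t - y0) \<le> B * h"
    "\<And>t. t \<in> {-h<..<h} \<Longrightarrow> (y has_vector_derivative F (y t)) (at t)"
    using global_lipschitz_local_solution[OF lip bd L(1) h Lh, of y0] by blast
  have yr: "y t \<in> cball y0 r" for t
    using order_trans[OF y(2) Bh, of t] by (simp add: dist_norm norm_minus_commute)
  then have "F (y t) = f (y t)" for t
    by (simp add: F_def closest_point_self)
  then show thesis using y yr r(2) h by (intro that[of h y]) (simp_all add: subsetD)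
qed

section \<open>Geodesics and the Thomas symbol\<close>

definition adj2 :: "real^2^2 \<Rightarrow> real^2^2" where
  "adj2 A = (\<chi> i j. if i = j then A $ (if i = 1 then 2 else 1) $ (if i = 1 then 2 else 1) else - A $ i $ j)"

lemma adj2_nth:
  "adj2 A $ 1 $ 1 = A $ 2 $ 2" "adj2 A $ 1 $ 2 = - A $ 1 $ 2"
  "adj2 A $ 2 $ 1 = - A $ 2 $ 1" "adj2 A $ 2 $ 2 = A $ 1 $ 1"
  by (simp_all add: adj2_def)

lemma matrix_inv_2:
  fixes A :: "real^2^2"
  assumes "det A \<noteq> 0"
  shows "matrix_inv A = adj2 A /\<^sub>R det A"
proof -
  have A: "A ** (adj2 A /\<^sub>R det A) = mat 1"
  proof -
    have "A ** adj2 A = det A *\<^sub>R mat 1"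
      by (simp add: vec_eq_iff forall_2 matrix_matrix_mult_def sum_2 adj2_nth mat_def det_2)
    then show ?thesis using assms by (simp add: matrix_scalar_ac scalar_matrix_assoc[symmetric])
  qed
  have "matrix_inv A ** A = mat 1"
    using invertible_det_nz[of A] assms someI_ex[of "\<lambda>B. A ** B = mat 1 \<and> B ** A = mat 1"]
    unfolding invertible_def matrix_inv_def by blast
  then show ?thesis
    by (metis A matrix_mul_assoc matrix_mul_lid matrix_mul_rid)
qed

lemma smooth_on_det_2:
  fixes A :: "'a::real_normed_vector \<Rightarrow> real^2^2"
  shows "open S \<Longrightarrow> smooth_on S A \<Longrightarrow> smooth_on S (\<lambda>x. det (A x))"
  unfolding det_2 by (intro smooth_on_intros smooth_on_nth)

lemma partial_deriv_cong:
  "open M \<Longrightarrow> x \<in> M \<Longrightarrow> (\<And>y. y \<in> M \<Longrightarrow> f y = g y) \<Longrightarrow> f differentiable (at x)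
    \<Longrightarrow> partial_deriv i f x = partial_deriv i g x"
  unfolding partial_deriv_def using frechet_derivative_transform_within_open[of f x M g] by simp

lemma symmetric_matrix_nth:
  assumes "transpose A = A"
  shows "A $ j $ i = A $ i $ j"
proof -
  have "A $ j $ i = transpose A $ i $ j" by (simp add: transpose_def)
  then show ?thesis using assms by simp
qed

lemma metric_on_symmetric: "metric_on M g \<Longrightarrow> x \<in> M \<Longrightarrow> g x $ j $ i = g x $ i $ j"
  unfolding metric_on_def using symmetric_matrix_nth by blast

lemma smooth_on_christoffel:
  assumes "open M" "metric_on M g"
  shows "smooth_on M (\<lambda>x. christoffel g x k i j)"
proof -
  have g: "smooth_on M g" and d: "\<And>x. x \<in> M \<Longrightarrow> det (g x) \<noteq> 0"
    using assms(2) by (auto simp: metric_on_def)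
  have inv: "smooth_on M (\<lambda>x. matrix_inv (g x) $ k $ l)" for l
  proof (rule smooth_on_cong[OF assms(1)])
    show "adj2 (g x) $ k $ l / det (g x) = matrix_inv (g x) $ k $ l" if "x \<in> M" for x
      using d[OF that] by (simp add: matrix_inv_2 divide_inverse ac_simps)
    have "smooth_on M (\<lambda>x. adj2 (g x) $ k $ l)"
      using exhaust_2[of k] exhaust_2[of l]
      by (elim disjE; simp add: adj2_nth; intro smooth_on_uminus smooth_on_nth assms(1) g)
    then show "smooth_on M (\<lambda>x. adj2 (g x) $ k $ l / det (g x))"
      by (intro smooth_on_intros smooth_on_det_2 assms(1) g d)
  qed
  have "smooth_on M (\<lambda>x. partial_deriv a (\<lambda>y. g y $ b $ c) x)" for a b c
    by (intro smooth_on_partial_deriv smooth_on_nth assms(1) g)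
  then show ?thesis
    unfolding christoffel_def sum_2 by (intro smooth_on_intros inv assms(1)) simp_all
qed

lemma christoffel_symmetric:
  assumes "open M" "metric_on M g" "x \<in> M"
  shows "christoffel g x k j i = christoffel g x k i j"
proof -
  have "partial_deriv l (\<lambda>y. g y $ j $ i) x = partial_deriv l (\<lambda>y. g y $ i $ j) x" for l
    using assms metric_on_symmetric[OF assms(2)] unfolding metric_on_def
    by (intro partial_deriv_cong[OF assms(1)])
       (auto intro!: smooth_on_differentiable[OF smooth_on_nth[OF assms(1) smooth_on_nth[OF assms(1)]]])
  then show ?thesis by (simp add: christoffel_def add.commute)
qed

section \<open>Smooth functions of position and velocity jointly\<close>

lemma smooth_on_ident:
  assumes "open S"
  shows "smooth_on S (\<lambda>x. x)"
  unfolding smooth_on_def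
proof
  fix k
  show "Ck_on k S (\<lambda>x. x)"
    by (cases k) (auto intro!: Ck_on_SucI[OF assms has_derivative_ident] Ck_on_const
        simp del: Ck_on.simps(2))
qed

lemma smooth_on_compose_linear:
  assumes "bounded_linear L" "open S" "smooth_on S f"
  shows "smooth_on (L -` S) (\<lambda>x. f (L x))"
proof -
  have op: "open (L -` S)"
    using assms(1,2) by (intro open_vimage) (auto intro: linear_continuous_on)
  have "Ck_on k (L -` S) (\<lambda>x. f (L x))" if "Ck_on k S f" for k
    using that
  proof (induction k arbitrary: f)
    case 0
    then show ?case
      using continuous_on_compose2[of S f "L -` S" L] linear_continuous_on[OF assms(1)] by auto
  next
    case (Suc k)
    have "((\<lambda>x. f (L x)) has_derivative (\<lambda>v. frechet_derivative f (at (L x)) (L v))) (at x)"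
      if "x \<in> L -` S" for x
      using that by (intro has_derivative_compose[OF bounded_linear_imp_has_derivative[OF assms(1)]]
          Ck_on_has_derivative[OF Suc.prems]) auto
    then show ?case
      by (rule Ck_on_SucI[OF op]) (use Suc in auto)
  qed
  then show ?thesis using assms(3) by (simp add: smooth_on_def)
qed

lemma smooth_on_vec2I:
  fixes f :: "'a::real_normed_vector \<Rightarrow> real^2"
  assumes "open S" "\<And>i. smooth_on S (\<lambda>x. f x $ i)"
  shows "smooth_on S f"
proof -
  have "f = (\<lambda>x. f x $ 1 *\<^sub>R axis 1 1 + f x $ 2 *\<^sub>R axis 2 1)"
    by (auto simp: fun_eq_iff vec_eq_iff forall_2 axis_def)
  moreover have "smooth_on S \<dots>"
    by (intro smooth_on_add smooth_on_scaleR_const assms)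
  ultimately show ?thesis by simp
qed

lemma smooth_on_Pair:
  assumes "open S" "smooth_on S f" "smooth_on S g"
  shows "smooth_on S (\<lambda>x. (f x, g x))"
proof -
  have "smooth_on S (\<lambda>x. (f x, 0) + (0, g x))"
    by (intro smooth_on_add smooth_on_bounded_linear[OF _ _ assms(2), of "\<lambda>y. (y, 0)"]
        smooth_on_bounded_linear[OF _ _ assms(3), of "\<lambda>y. (0, y)"] assms(1)
        bounded_linear_Pair bounded_linear_ident bounded_linear_zero)
  then show ?thesis by simp
qed

section \<open>Existence of geodesics and comparison of accelerations\<close>

definition geodesic_accel :: "(real^2 \<Rightarrow> real^2^2) \<Rightarrow> real^2 \<Rightarrow> real^2 \<Rightarrow> real^2" where
  "geodesic_accel g x v = (\<chi> k. - (\<Sum>i\<in>UNIV. \<Sum>j\<in>UNIV. christoffel g x k i j * v $ i * v $ j))"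

text \<open>The geodesic equation becomes a first-order system for position and velocity. Zero
  velocity is removed from its domain, since \<open>geodesic_on\<close> asks for a nowhere vanishing
  velocity.\<close>

lemma geodesic_exists:
  assumes "open M" "metric_on M g" "x \<in> M" "v \<noteq> 0"
  obtains J \<gamma> where "geodesic_on M g J \<gamma>" "0 \<in> J" "\<gamma> 0 = x" "(\<gamma> has_vector_derivative v) (at 0)"
proof -
  define S where "S = M \<times> (UNIV - {0 :: real^2})"
  have S: "open S" using assms(1) by (auto simp: S_def intro: open_Times open_delete)
  have opM: "open (M \<times> (UNIV :: (real^2) set))" using assms(1) by (intro open_Times) auto
  define f where "f = (\<lambda>z. (snd z, geodesic_accel g (fst z) (snd z)))"
  have vel: "smooth_on S snd"
    using smooth_on_bounded_linear[OF S bounded_linear_snd smooth_on_ident[OF S]] .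
  have chr: "smooth_on S (\<lambda>z. christoffel g (fst z) k i j)" for k i j
    by (rule smooth_on_subset[OF smooth_on_compose_linear[OF bounded_linear_fst assms(1)
          smooth_on_christoffel[OF assms(1,2)]]])
       (auto simp: S_def)
  have "smooth_on S f"
    unfolding f_def
    by (intro smooth_on_Pair vel smooth_on_vec2I S)
       (auto simp: geodesic_accel_def sum_2 intro!: smooth_on_intros chr smooth_on_nth vel S)
  moreover have "(x, v) \<in> S" using assms by (simp add: S_def)
  ultimately obtain h y where y: "0 < h" "y 0 = (x, v)"
    "\<And>t. t \<in> {-h<..<h} \<Longrightarrow> y t \<in> S \<and> (y has_vector_derivative f (y t)) (at t)"
    using smooth_ode_local_solution[OF S] by metis
  have d1: "((\<lambda>t. fst (y t)) has_vector_derivative snd (y t)) (at t)"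
    and d2: "((\<lambda>t. snd (y t)) has_vector_derivative geodesic_accel g (fst (y t)) (snd (y t))) (at t)"
    if "t \<in> {-h<..<h}" for t
    using bounded_linear.has_vector_derivative[OF bounded_linear_fst, of y "f (y t)" "at t"]
      bounded_linear.has_vector_derivative[OF bounded_linear_snd, of y "f (y t)" "at t"] y(3)[OF that]
    by (simp_all add: f_def)
  show thesis
  proof (rule that[of "{-h<..<h}" "\<lambda>t. fst (y t)"])
    show "geodesic_on M g {-h<..<h} (\<lambda>t. fst (y t))"
      unfolding geodesic_on_def
    proof (intro conjI exI[of _ "\<lambda>t. snd (y t)"] ballI)
      fix t assume t: "t \<in> {-h<..<h}"
      show "fst (y t) \<in> M" "snd (y t) \<noteq> 0" using y(3)[OF t] by (auto simp: S_def mem_Times_iff)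
      show "((\<lambda>t. fst (y t)) has_vector_derivative snd (y t)) (at t)" by (rule d1[OF t])
      show "((\<lambda>t. snd (y t)) has_vector_derivative
          (\<chi> k. - (\<Sum>i\<in>UNIV. \<Sum>j\<in>UNIV. christoffel g (fst (y t)) k i j * snd (y t) $ i * snd (y t) $ j))) (at t)"
        using d2[OF t] by (simp add: geodesic_accel_def)
    qed (use y(1) in \<open>auto intro: is_interval_oo\<close>)
    show "((\<lambda>t. fst (y t)) has_vector_derivative v) (at 0)"
      using d1[of 0] y(1,2) by simp
  qed (use y in auto)
qed

text \<open>Follow the g-geodesic with velocity v at x and reparametrize it by \<phi>. Its
  acceleration becomes (\<phi>')^2 times the old one plus \<phi>'' v, and its velocity \<phi>' v.
  Acceleration is quadratic in the velocity, so dividing by (\<phi>')^2 gives c = \<phi>'' /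
  (\<phi>')^2.\<close>

lemma geodesics_reparametrize_accel:
  assumes "open M" "metric_on M g" "geodesics_reparametrize M g h" "x \<in> M" "v \<noteq> 0"
  obtains c where "geodesic_accel h x v = geodesic_accel g x v + c *\<^sub>R v"
proof -
  obtain J \<gamma> where \<gamma>: "geodesic_on M g J \<gamma>" "0 \<in> J" "\<gamma> 0 = x" "(\<gamma> has_vector_derivative v) (at 0)"
    using geodesic_exists[OF assms(1,2,4,5)] .
  obtain J' \<phi> where \<phi>: "reparametrization J' J \<phi>" "geodesic_on M h J' (\<gamma> \<circ> \<phi>)"
    using assms(3) \<gamma>(1) unfolding geodesics_reparametrize_def by blast
  obtain u where u: "\<And>s. s \<in> J \<Longrightarrow> (\<gamma> has_vector_derivative u s) (at s)"
    "\<And>s. s \<in> J \<Longrightarrow> (u has_vector_derivative geodesic_accel g (\<gamma> s) (u s)) (at s)"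
    using \<gamma>(1) unfolding geodesic_on_def geodesic_accel_def by blast
  obtain w where w: "\<And>s. s \<in> J' \<Longrightarrow> (\<gamma> \<circ> \<phi> has_vector_derivative w s) (at s)"
    "\<And>s. s \<in> J' \<Longrightarrow> (w has_vector_derivative geodesic_accel h ((\<gamma> \<circ> \<phi>) s) (w s)) (at s)"
    and J': "open J'"
    using \<phi>(2) unfolding geodesic_on_def geodesic_accel_def by blast
  have bij: "bij_betw \<phi> J' J" and sm: "smooth_on J' \<phi>" and nz: "\<And>s. s \<in> J' \<Longrightarrow> deriv \<phi> s \<noteq> 0"
    using \<phi>(1) by (auto simp: reparametrization_def)
  obtain s0 where s0: "s0 \<in> J'" "\<phi> s0 = 0"
    using bij \<gamma>(2) by (metis bij_betw_iff_bijections)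
  have \<phi>J: "\<phi> s \<in> J" if "s \<in> J'" for s using bij that by (metis bij_betwE)
  have d\<phi>: "(\<phi> has_real_derivative deriv \<phi> s) (at s)" if "s \<in> J'" for s
    using smooth_on_differentiable[OF sm that]
    by (simp add: DERIV_deriv_iff_real_differentiable)
  have fd: "frechet_derivative \<phi> (at s) 1 = deriv \<phi> s" if "s \<in> J'" for s
    using frechet_derivative_at[of \<phi> "(*) (deriv \<phi> s)" s] d\<phi>[OF that]
    unfolding has_field_derivative_def by (metis mult.right_neutral)
  \<comment> \<open>Smoothness of \<phi> speaks of \<open>frechet_derivative\<close> in direction 1.
    On \<open>J'\<close> this is \<open>deriv \<phi>\<close>, which therefore has a derivative e at
    \<open>s0\<close>, the second derivative of \<phi>.\<close>
  obtain D where "((\<lambda>s. frechet_derivative \<phi> (at s) 1) has_derivative D) (at s0)"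
    using smooth_on_differentiable[OF smooth_on_frechet_derivative[OF sm, of 1] s0(1)]
    unfolding differentiable_def by blast
  then have "(deriv \<phi> has_derivative D) (at s0)"
    by (rule has_derivative_transform_within_open[OF _ J' s0(1) fd])
  then have "deriv \<phi> differentiable (at s0)"
    unfolding differentiable_def by blast
  then obtain e where e: "(deriv \<phi> has_real_derivative e) (at s0)"
    using real_differentiable_def by blast
  have weq: "w s = deriv \<phi> s *\<^sub>R u (\<phi> s)" if "s \<in> J'" for s
  proof (rule vector_derivative_unique_at[OF w(1)[OF that]])
    show "(\<gamma> \<circ> \<phi> has_vector_derivative deriv \<phi> s *\<^sub>R u (\<phi> s)) (at s)"
      using d\<phi>[OF that] u(1)[OF \<phi>J[OF that]]
      by (intro vector_diff_chain_at) (simp_all add: has_real_derivative_iff_has_vector_derivative)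
  qed
  have u0: "u 0 = v" using vector_derivative_unique_at[OF u(1)[OF \<gamma>(2)] \<gamma>(4)] .
  let ?a = "deriv \<phi> s0"
  have "(u \<circ> \<phi> has_vector_derivative ?a *\<^sub>R geodesic_accel g x v) (at s0)"
    using vector_diff_chain_at[of \<phi> ?a s0 u] u(2)[OF \<gamma>(2)] d\<phi>[OF s0(1)] s0(2) u0 \<gamma>(3)
    by (simp add: has_real_derivative_iff_has_vector_derivative)
  from has_vector_derivative_scaleR[OF e this]
  have "((\<lambda>s. deriv \<phi> s *\<^sub>R u (\<phi> s)) has_vector_derivative
      ?a *\<^sub>R (?a *\<^sub>R geodesic_accel g x v) + e *\<^sub>R v) (at s0)"
    using s0(2) u0 by (simp add: o_def)
  then have "(w has_vector_derivative ?a *\<^sub>R (?a *\<^sub>R geodesic_accel g x v) + e *\<^sub>R v) (at s0)"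
    by (rule has_vector_derivative_transform_within_open[OF _ J' s0(1)]) (simp add: weq)
  then have "geodesic_accel h x (?a *\<^sub>R v) = ?a *\<^sub>R (?a *\<^sub>R geodesic_accel g x v) + e *\<^sub>R v"
    using vector_derivative_unique_at[OF w(2)[OF s0(1)]] weq[OF s0(1)] s0(2) u0 \<gamma>(3) by simp
  moreover have "geodesic_accel h x (?a *\<^sub>R v) = (?a * ?a) *\<^sub>R geodesic_accel h x v"
    by (simp add: geodesic_accel_def vec_eq_iff sum_2 algebra_simps)
  ultimately have "(?a * ?a) *\<^sub>R geodesic_accel h x v
      = (?a * ?a) *\<^sub>R (geodesic_accel g x v + (e / (?a * ?a)) *\<^sub>R v)"
    using nz[OF s0(1)] by (simp add: scaleR_add_right)
  then show thesis using nz[OF s0(1)] by (intro that[of "e / (?a * ?a)"]) simp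
qed

text \<open>The four independent components of the trace-free part
  \<open>\<Gamma>\<^sup>k\<^sub>i\<^sub>j - (\<delta>\<^sup>k\<^sub>i \<Gamma>\<^sup>l\<^sub>l\<^sub>j + \<delta>\<^sup>k\<^sub>j \<Gamma>\<^sup>l\<^sub>l\<^sub>i) / 3\<close>: it is the tuple
  \<open>(\<Pi>\<^sup>1\<^sub>1\<^sub>1, \<Pi>\<^sup>1\<^sub>1\<^sub>2, \<Pi>\<^sup>1\<^sub>2\<^sub>2, \<Pi>\<^sup>2\<^sub>1\<^sub>1)\<close>,
  and \<open>\<Pi>\<^sup>2\<^sub>1\<^sub>2 = - \<Pi>\<^sup>1\<^sub>1\<^sub>1\<close>, \<open>\<Pi>\<^sup>2\<^sub>2\<^sub>2 = - \<Pi>\<^sup>1\<^sub>1\<^sub>2\<close>.\<close>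

definition thomas :: "(real^2 \<Rightarrow> real^2^2) \<Rightarrow> real^2 \<Rightarrow> real \<times> real \<times> real \<times> real" where
  "thomas g x = ((christoffel g x 1 1 1 - 2 * christoffel g x 2 1 2) / 3,
     (2 * christoffel g x 1 1 2 - christoffel g x 2 2 2) / 3,
     christoffel g x 1 2 2, christoffel g x 2 1 1)"

text \<open>Crossing the acceleration with v = (a, b) removes every multiple of v and leaves a
  binary cubic in a and b, whose coefficients are, up to nonzero constants, the four components of
  the Thomas symbol. Values in four pairwise independent directions determine a binary
  cubic.\<close>

lemma thomas_projectively_invariant:
  assumes "open M" "metric_on M g" "metric_on M h" "geodesics_reparametrize M g h" "x \<in> M"
  shows "thomas h x = thomas g x"
proof -
  have sym: "christoffel g x k 2 1 = christoffel g x k 1 2"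
    "christoffel h x k 2 1 = christoffel h x k 1 2" for k
    using christoffel_symmetric assms by blast+
  have "geodesic_accel h x (vector [a, b]) $ 1 * b - geodesic_accel h x (vector [a, b]) $ 2 * a
      = geodesic_accel g x (vector [a, b]) $ 1 * b - geodesic_accel g x (vector [a, b]) $ 2 * a"
    if nz: "a \<noteq> 0 \<or> b \<noteq> 0" for a b :: real
  proof -
    have "(vector [a, b] :: real^2) \<noteq> 0" using nz by (simp add: vec_eq_iff forall_2)
    then obtain c where "geodesic_accel h x (vector [a, b])
        = geodesic_accel g x (vector [a, b]) + c *\<^sub>R vector [a, b]"
      using geodesics_reparametrize_accel[OF assms(1,2,4,5)] by metis
    then show ?thesis by (simp add: algebra_simps)
  qed
  from this[of 1 0] this[of 0 1] this[of 1 1] this[of 1 "-1"] show ?thesis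
    by (simp add: geodesic_accel_def sum_2 sym thomas_def)
qed

section \<open>The projective form of the Killing equation\<close>

text \<open>For a symmetric \<open>\<kappa>\<close> the four equations are the coefficients in \<open>q\<close> of
  \<open>\<partial>\<^sub>k \<kappa>\<^sub>i\<^sub>j q\<^sup>i q\<^sup>j q\<^sup>k = 2 \<kappa>\<^sub>l\<^sub>k \<Pi>\<^sup>l\<^sub>i\<^sub>j q\<^sup>i q\<^sup>j q\<^sup>k\<close>.\<close>

definition killing_eq ::
  "real \<times> real \<times> real \<times> real \<Rightarrow> (real^2 \<Rightarrow> real^2^2) \<Rightarrow> real^2 \<Rightarrow> bool" where
  "killing_eq T \<kappa> x \<longleftrightarrow> (case T of (P, Q, R, S) \<Rightarrow>
     (let d = (\<lambda>i j k. partial_deriv k (\<lambda>y. \<kappa> y $ i $ j) x);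
         a = \<kappa> x $ 1 $ 1; b = \<kappa> x $ 1 $ 2; c = \<kappa> x $ 2 $ 2
     in d 1 1 1 = 2 * (a * P + b * S)
      \<and> 2 * d 1 2 1 + d 1 1 2 = 2 * (2 * a * Q - b * P + c * S)
      \<and> d 2 2 1 + 2 * d 1 2 2 = 2 * (a * R + b * Q - 2 * c * P)
      \<and> d 2 2 2 = 2 * (b * R - c * Q)))"

definition weighted :: "(real^2 \<Rightarrow> real^2^2) \<Rightarrow> real^2 \<Rightarrow> real^2^2" where
  "weighted g x = g x /\<^sub>R (\<bar>det (g x)\<bar> powr (2/3))"

lemma partial_derivI:
  "(f has_derivative f') (at x) \<Longrightarrow> partial_deriv i f x = f' (axis i 1)"
  by (simp add: partial_deriv_def frechet_derivative_at[symmetric])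

lemma has_derivative_partials:
  fixes f :: "real^2 \<Rightarrow> real"
  assumes "f differentiable (at x)"
  shows "(f has_derivative (\<lambda>u. u $ 1 * partial_deriv 1 f x + u $ 2 * partial_deriv 2 f x)) (at x)"
proof -
  have f': "(f has_derivative frechet_derivative f (at x)) (at x)"
    using assms frechet_derivative_works by blast
  interpret bounded_linear "frechet_derivative f (at x)"
    using has_derivative_bounded_linear[OF f'] .
  have "frechet_derivative f (at x) u = u $ 1 * partial_deriv 1 f x + u $ 2 * partial_deriv 2 f x" for u
  proof -
    have "u = u $ 1 *\<^sub>R axis 1 1 + u $ 2 *\<^sub>R axis 2 1"
      by (simp add: vec_eq_iff forall_2 axis_def)
    then show ?thesis
      using add scaleR by (metis partial_deriv_def real_scaleR_def)
  qed
  then have "frechet_derivative f (at x)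
      = (\<lambda>u. u $ 1 * partial_deriv 1 f x + u $ 2 * partial_deriv 2 f x)" by blast
  with f' show ?thesis by simp
qed

text \<open>The algebra behind \<open>killing_eq_weighted\<close>. A, B, C are the entries of g, A1,
  A2 and so on their partial derivatives, f is 1 / (2 det g), the G are Christoffel symbols, and d1,
  d2 are the derivatives of log |det g|. After clearing the denominator 3, each defect is a
  combination of derivatives of g times 1 - 2 f det g, which vanishes.\<close>

lemma thomas_identity:
  fixes A B C :: real
  assumes f: "2 * f * (A * C - B * B) = 1"
    and G: "G111 = f * (C * A1 - B * (2 * B1 - A2))" "G112 = f * (C * A2 - B * C1)"
      "G122 = f * (C * (2 * B2 - C1) - B * C2)"
      "G211 = f * (A * (2 * B1 - A2) - B * A1)" "G212 = f * (A * C1 - B * A2)"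
      "G222 = f * (A * C2 - B * (2 * B2 - C1))"
    and d: "d1 = 2 * f * (A1 * C + A * C1 - 2 * B * B1)" "d2 = 2 * f * (A2 * C + A * C2 - 2 * B * B2)"
  shows "A1 - 2 / 3 * (A * d1) = 2 * (A * ((G111 - 2 * G212) / 3) + B * G211)" (is ?t1)
    and "2 * (B1 - 2 / 3 * (B * d1)) + (A2 - 2 / 3 * (A * d2))
      = 2 * (2 * A * ((2 * G112 - G222) / 3) - B * ((G111 - 2 * G212) / 3) + C * G211)" (is ?t2)
    and "(C1 - 2 / 3 * (C * d1)) + 2 * (B2 - 2 / 3 * (B * d2))
      = 2 * (A * G122 + B * ((2 * G112 - G222) / 3) - 2 * C * ((G111 - 2 * G212) / 3))" (is ?t3)
    and "C2 - 2 / 3 * (C * d2) = 2 * (B * G122 - C * ((2 * G112 - G222) / 3))" (is ?t4)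
proof -
  have "3 * A1 - 2 * (A * d1) - 2 * (A * (G111 - 2 * G212) + 3 * B * G211)
      = 3 * A1 * (1 - 2 * f * (A * C - B * B))"
    unfolding G d by (simp add: algebra_simps)
  then show ?t1 unfolding f by (simp add: field_simps)
  have "6 * B1 - 4 * (B * d1) + 3 * A2 - 2 * (A * d2)
        - 2 * (2 * A * (2 * G112 - G222) - B * (G111 - 2 * G212) + 3 * C * G211)
      = (6 * B1 + 3 * A2) * (1 - 2 * f * (A * C - B * B))"
    unfolding G d by (simp add: algebra_simps)
  then show ?t2 unfolding f by (simp add: field_simps)
  have "3 * C1 - 2 * (C * d1) + 6 * B2 - 4 * (B * d2)
        - 2 * (3 * A * G122 + B * (2 * G112 - G222) - 2 * C * (G111 - 2 * G212))
      = (3 * C1 + 6 * B2) * (1 - 2 * f * (A * C - B * B))"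
    unfolding G d by (simp add: algebra_simps)
  then show ?t3 unfolding f by (simp add: field_simps)
  have "3 * C2 - 2 * (C * d2) - 2 * (3 * B * G122 - C * (2 * G112 - G222))
      = 3 * C2 * (1 - 2 * f * (A * C - B * B))"
    unfolding G d by (simp add: algebra_simps)
  then show ?t4 unfolding f by (simp add: field_simps)
qed

text \<open>The Levi-Civita property makes g satisfy the Killing equation with \<Gamma> in place of
  \<Pi>. The trace of \<Gamma> is half the derivative of log |det g|; splitting it off leaves the
  term (2/3) g d log |det g|, which the weight |det g|^(-2/3) cancels exactly.\<close>

lemma killing_eq_weighted:
  assumes "open M" "metric_on M g" "x \<in> M"
  shows "killing_eq (thomas g x) (weighted g) x"
proof -
  have gs: "smooth_on M g" and d: "det (g x) \<noteq> 0"
    using assms by (auto simp: metric_on_def)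
  have diff: "(\<lambda>y. g y $ i $ j) differentiable (at x)" for i j
    by (intro smooth_on_differentiable[OF _ assms(3)] smooth_on_nth assms(1) gs)
  define D where "D k i j = partial_deriv k (\<lambda>y. g y $ i $ j) x" for k i j
  have sym: "g x $ 2 $ 1 = g x $ 1 $ 2" by (rule metric_on_symmetric[OF assms(2,3)])
  have Dsym: "D k 2 1 = D k 1 2" for k
    unfolding D_def using metric_on_symmetric[OF assms(2)] diff
    by (intro partial_deriv_cong[OF assms(1,3)]) auto
  have Dd: "((\<lambda>y. g y $ i $ j) has_derivative (\<lambda>u. u $ 1 * D 1 i j + u $ 2 * D 2 i j)) (at x)" for i j
    unfolding D_def by (rule has_derivative_partials[OF diff])
  let ?A = "g x $ 1 $ 1" and ?B = "g x $ 1 $ 2" and ?C = "g x $ 2 $ 2"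
  have det: "det (g x) = ?A * ?C - ?B * ?B" by (simp add: det_2 sym)
  define f where "f = inverse (2 * det (g x))"
  have f: "2 * f * (?A * ?C - ?B * ?B) = 1" using d by (simp add: f_def det[symmetric])
  \<comment> \<open>\<open>\<delta> k\<close> is the logarithmic derivative of det g. The weight E
    is a common factor of both sides, so the identities of \<open>thomas_identity\<close> only have
    to be multiplied by E.\<close>
  define \<delta> where "\<delta> k = 2 * f * (D k 1 1 * ?C + ?A * D k 2 2 - 2 * ?B * D k 1 2)" for k
  define E where "E = inverse (\<bar>det (g x)\<bar> powr (2/3))"
  have "((\<lambda>y. det (g y)) has_derivative (\<lambda>u. u $ 1 * (D 1 1 1 * ?C + ?A * D 1 2 2 - 2 * ?B * D 1 1 2)
      + u $ 2 * (D 2 1 1 * ?C + ?A * D 2 2 2 - 2 * ?B * D 2 1 2))) (at x)"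
    unfolding det_2 by (rule has_derivative_eq_rhs[OF has_derivative_diff[OF has_derivative_mult[OF Dd Dd]
            has_derivative_mult[OF Dd Dd]]]) (simp add: sym Dsym fun_eq_iff algebra_simps)
  from has_derivative_abs_powr[OF this d, of "-2/3"]
  have dE: "((\<lambda>y. inverse (\<bar>det (g y)\<bar> powr (2/3))) has_derivative
      (\<lambda>u. - 2 / 3 * (E * (u $ 1 * \<delta> 1 + u $ 2 * \<delta> 2)))) (at x)"
    by (simp add: E_def \<delta>_def f_def powr_minus algebra_simps)
  have pd: "partial_deriv k (\<lambda>y. weighted g y $ i $ j) x
      = E * (D k i j - 2 / 3 * (g x $ i $ j * \<delta> k))" for k i j
  proof -
    have "((\<lambda>y. weighted g y $ i $ j) has_derivative (\<lambda>u. E * (u $ 1 * D 1 i j + u $ 2 * D 2 i j)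
        + (- 2 / 3 * (E * (u $ 1 * \<delta> 1 + u $ 2 * \<delta> 2))) * g x $ i $ j)) (at x)"
      using has_derivative_mult[OF dE Dd[of i j]] by (simp add: weighted_def E_def)
    from partial_derivI[OF this, of k] show ?thesis
      using exhaust_2[of k] by (auto simp: axis_def algebra_simps)
  qed
  have w: "weighted g x $ i $ j = E * g x $ i $ j" for i j
    by (simp add: weighted_def E_def)
  have inv: "matrix_inv (g x) $ 1 $ 1 = 2 * f * ?C" "matrix_inv (g x) $ 1 $ 2 = - 2 * f * ?B"
    "matrix_inv (g x) $ 2 $ 1 = - 2 * f * ?B" "matrix_inv (g x) $ 2 $ 2 = 2 * f * ?A"
    using d by (simp_all add: matrix_inv_2 adj2_nth sym f_def)
  note \<Gamma> = christoffel_def sum_2 inv D_def[symmetric] Dsym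
  have "christoffel g x 1 1 1 = f * (?C * D 1 1 1 - ?B * (2 * D 1 1 2 - D 2 1 1))"
    "christoffel g x 1 1 2 = f * (?C * D 2 1 1 - ?B * D 1 2 2)"
    "christoffel g x 1 2 2 = f * (?C * (2 * D 2 1 2 - D 1 2 2) - ?B * D 2 2 2)"
    "christoffel g x 2 1 1 = f * (?A * (2 * D 1 1 2 - D 2 1 1) - ?B * D 1 1 1)"
    "christoffel g x 2 1 2 = f * (?A * D 1 2 2 - ?B * D 2 1 1)"
    "christoffel g x 2 2 2 = f * (?A * D 2 2 2 - ?B * (2 * D 2 1 2 - D 1 2 2))"
    unfolding \<Gamma> by (simp_all add: field_simps)
  note t = thomas_identity[OF f this \<delta>_def[of 1] \<delta>_def[of 2]]
  show ?thesis
    unfolding killing_eq_def thomas_def prod.case Let_def pd w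
    using t[THEN arg_cong[where f = "\<lambda>r. E * r"]]
    by (simp add: algebra_simps)
qed

section \<open>Quadratic functions on phase space\<close>

text \<open>A contravariant tensor \<open>K\<close> is encoded by \<open>\<kappa>\<close> with \<open>K = adj \<psi> \<kappa> adj \<psi>\<close>, so that
  \<open>K\<^sup>i\<^sup>j p\<^sub>i p\<^sub>j = \<kappa>\<^sub>i\<^sub>j q\<^sup>i q\<^sup>j\<close> for \<open>q = adj \<psi> p\<close>; the metric itself corresponds to \<open>\<kappa> = \<psi>\<close>.\<close>

definition adj_vec :: "real^2^2 \<Rightarrow> real^2 \<Rightarrow> real^2" where
  "adj_vec A p = vector [A $ 2 $ 2 * p $ 1 - A $ 1 $ 2 * p $ 2, A $ 1 $ 1 * p $ 2 - A $ 1 $ 2 * p $ 1]"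

text \<open>\<open>adj_vec\<close>, \<open>quad_form\<close> and \<open>quad_grad\<close> read only
  the upper off-diagonal entry. The calculus below is thus free of symmetry hypotheses; symmetry
  enters in the comparison with genuine tensors.\<close>

definition quad_form :: "real^2^2 \<Rightarrow> real^2 \<Rightarrow> real" where
  "quad_form A q = A $ 1 $ 1 * (q $ 1)\<^sup>2 + 2 * A $ 1 $ 2 * q $ 1 * q $ 2 + A $ 2 $ 2 * (q $ 2)\<^sup>2"

definition quad_grad :: "real^2^2 \<Rightarrow> real^2 \<Rightarrow> real^2" where
  "quad_grad A q = vector [2 * (A $ 1 $ 1 * q $ 1 + A $ 1 $ 2 * q $ 2), 2 * (A $ 1 $ 2 * q $ 1 + A $ 2 $ 2 * q $ 2)]"

text \<open>The gradient in x with q held fixed. The dependence of q = adj \<psi> p on x is added in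
  \<open>phase_dx\<close>.\<close>

definition base_grad ::
  "(real^2 \<Rightarrow> real^2^2) \<Rightarrow> (real^2 \<Rightarrow> real) \<Rightarrow> real^2 \<Rightarrow> real^2 \<Rightarrow> real^2" where
  "base_grad \<kappa> W x q = (\<chi> i. partial_deriv i (\<lambda>y. \<kappa> y $ 1 $ 1) x * (q $ 1)\<^sup>2
     + 2 * partial_deriv i (\<lambda>y. \<kappa> y $ 1 $ 2) x * q $ 1 * q $ 2
     + partial_deriv i (\<lambda>y. \<kappa> y $ 2 $ 2) x * (q $ 2)\<^sup>2 + partial_deriv i W x)"

definition phase_fun ::
  "(real^2 \<Rightarrow> real^2^2) \<Rightarrow> (real^2 \<Rightarrow> real^2^2) \<Rightarrow> (real^2 \<Rightarrow> real) \<Rightarrow> (real^2) \<times> (real^2) \<Rightarrow> real" where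
  "phase_fun \<psi> \<kappa> W z = quad_form (\<kappa> (fst z)) (adj_vec (\<psi> (fst z)) (snd z)) + W (fst z)"

definition diff_data :: "(real^2 \<Rightarrow> real^2^2) \<Rightarrow> real^2 \<Rightarrow> bool" where
  "diff_data \<kappa> x \<longleftrightarrow> (\<forall>i j. (\<lambda>y. \<kappa> y $ i $ j) differentiable (at x))"

definition phase_dx where
  "phase_dx \<psi> \<kappa> W x p i = base_grad \<kappa> W x (adj_vec (\<psi> x) p) $ i
    + quad_grad (\<kappa> x) (adj_vec (\<psi> x) p) $ 1 * (partial_deriv i (\<lambda>y. \<psi> y $ 2 $ 2) x * p $ 1
        - partial_deriv i (\<lambda>y. \<psi> y $ 1 $ 2) x * p $ 2)
    + quad_grad (\<kappa> x) (adj_vec (\<psi> x) p) $ 2 * (partial_deriv i (\<lambda>y. \<psi> y $ 1 $ 1) x * p $ 2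
        - partial_deriv i (\<lambda>y. \<psi> y $ 1 $ 2) x * p $ 1)"

lemma phase_fun_has_derivative:
  assumes "diff_data \<psi> x" "diff_data \<kappa> x" "W differentiable (at x)"
  shows "(phase_fun \<psi> \<kappa> W has_derivative (\<lambda>v. fst v $ 1 * phase_dx \<psi> \<kappa> W x p 1
     + fst v $ 2 * phase_dx \<psi> \<kappa> W x p 2
     + adj_vec (\<psi> x) (quad_grad (\<kappa> x) (adj_vec (\<psi> x) p)) \<bullet> snd v)) (at (x, p))"
proof -
  have lift: "((\<lambda>z. f (fst z)) has_derivative
      (\<lambda>v. fst v $ 1 * partial_deriv 1 f x + fst v $ 2 * partial_deriv 2 f x)) (at (x, p))"
    if "f differentiable (at x)" for f :: "real^2 \<Rightarrow> real"
    using has_derivative_compose[OF has_derivative_fst[OF has_derivative_ident], of f _ "(x, p)" UNIV]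
      has_derivative_partials[OF that] by simp
  have \<psi>: "((\<lambda>z. \<psi> (fst z) $ i $ j) has_derivative (\<lambda>v. fst v $ 1 * partial_deriv 1 (\<lambda>y. \<psi> y $ i $ j) x
      + fst v $ 2 * partial_deriv 2 (\<lambda>y. \<psi> y $ i $ j) x)) (at (x, p))" for i j
    using lift[of "\<lambda>y. \<psi> y $ i $ j"] assms(1) by (simp add: diff_data_def)
  have \<kappa>: "((\<lambda>z. \<kappa> (fst z) $ i $ j) has_derivative (\<lambda>v. fst v $ 1 * partial_deriv 1 (\<lambda>y. \<kappa> y $ i $ j) x
      + fst v $ 2 * partial_deriv 2 (\<lambda>y. \<kappa> y $ i $ j) x)) (at (x, p))" for i j
    using lift[of "\<lambda>y. \<kappa> y $ i $ j"] assms(2) by (simp add: diff_data_def)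
  have p: "((\<lambda>z. snd z $ i) has_derivative (\<lambda>v. snd v $ i)) (at (x, p))" for i
    using bounded_linear_imp_has_derivative[OF bounded_linear_compose[OF bounded_linear_vec_nth bounded_linear_snd]] .
  define q1 where "q1 z = \<psi> (fst z) $ 2 $ 2 * snd z $ 1 - \<psi> (fst z) $ 1 $ 2 * snd z $ 2" for z :: "(real^2) \<times> (real^2)"
  define q2 where "q2 z = \<psi> (fst z) $ 1 $ 1 * snd z $ 2 - \<psi> (fst z) $ 1 $ 2 * snd z $ 1" for z :: "(real^2) \<times> (real^2)"
  note dq1 = has_derivative_diff[OF has_derivative_mult[OF \<psi>[of 2 2] p[of 1]]
      has_derivative_mult[OF \<psi>[of 1 2] p[of 2]], folded q1_def]
  note dq2 = has_derivative_diff[OF has_derivative_mult[OF \<psi>[of 1 1] p[of 2]]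
      has_derivative_mult[OF \<psi>[of 1 2] p[of 1]], folded q2_def]
  have q: "adj_vec (\<psi> (fst z)) (snd z) = vector [q1 z, q2 z]" for z
    by (simp add: adj_vec_def q1_def q2_def)
  have eq: "phase_fun \<psi> \<kappa> W = (\<lambda>z. \<kappa> (fst z) $ 1 $ 1 * (q1 z * q1 z)
      + 2 * (\<kappa> (fst z) $ 1 $ 2 * (q1 z * q2 z)) + \<kappa> (fst z) $ 2 $ 2 * (q2 z * q2 z) + W (fst z))"
    by (simp add: phase_fun_def q quad_form_def power2_eq_square fun_eq_iff)
  have qx: "adj_vec (\<psi> x) p = vector [q1 (x, p), q2 (x, p)]"
    using q[of "(x, p)"] by simp
  show ?thesis
    unfolding eq
    by (rule has_derivative_eq_rhs,
        (rule has_derivative_const has_derivative_add has_derivative_mult dq1 dq2 \<kappa> lift[OF assms(3)])+,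
        simp only: phase_dx_def qx,
        simp add: fun_eq_iff base_grad_def quad_grad_def adj_vec_def inner_vec_def sum_2,
        simp add: algebra_simps power2_eq_square)
qed

lemma phase_fun_partials:
  assumes "diff_data \<psi> x" "diff_data \<kappa> x" "W differentiable (at x)"
  shows "frechet_derivative (phase_fun \<psi> \<kappa> W) (at (x, p)) (axis i 1, 0) = phase_dx \<psi> \<kappa> W x p i"
    and "frechet_derivative (phase_fun \<psi> \<kappa> W) (at (x, p)) (0, axis i 1)
      = adj_vec (\<psi> x) (quad_grad (\<kappa> x) (adj_vec (\<psi> x) p)) $ i"
  unfolding frechet_derivative_at[OF phase_fun_has_derivative[OF assms, of p], symmetric]
  using exhaust_2[of i] by (auto simp: axis_def inner_vec_def sum_2)

section \<open>The Poisson bracket in terms of projective data\<close>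

definition potential_eq :: "real^2 \<Rightarrow> (real^2 \<Rightarrow> real^2^2) \<Rightarrow> (real^2 \<Rightarrow> real) \<Rightarrow> real^2 \<Rightarrow> bool" where
  "potential_eq U \<psi> V x \<longleftrightarrow>
     partial_deriv 1 V x = \<psi> x $ 1 $ 1 * U $ 1 + \<psi> x $ 1 $ 2 * U $ 2 \<and>
     partial_deriv 2 V x = \<psi> x $ 1 $ 2 * U $ 1 + \<psi> x $ 2 $ 2 * U $ 2"

text \<open>The derivative of \<kappa>(q, q) + W along the vector field q d/dx - (\<Pi>(q, q) + U/2)
  d/dq: the projective spray with a force term.\<close>

definition integral_form :: "real \<times> real \<times> real \<times> real \<Rightarrow> real^2 \<Rightarrow> (real^2 \<Rightarrow> real^2^2)
    \<Rightarrow> (real^2 \<Rightarrow> real) \<Rightarrow> real^2 \<Rightarrow> real^2 \<Rightarrow> real" where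
  "integral_form T U \<kappa> W x q = (case T of (P, Q, R, S) \<Rightarrow>
     base_grad \<kappa> W x q $ 1 * q $ 1 + base_grad \<kappa> W x q $ 2 * q $ 2
     - (P * (q $ 1)\<^sup>2 + 2 * Q * q $ 1 * q $ 2 + R * (q $ 2)\<^sup>2 + U $ 1 / 2) * quad_grad (\<kappa> x) q $ 1
     - (S * (q $ 1)\<^sup>2 - 2 * P * q $ 1 * q $ 2 - Q * (q $ 2)\<^sup>2 + U $ 2 / 2) * quad_grad (\<kappa> x) q $ 2)"

text \<open>a, b, c are the entries of \<psi>, r its q-gradient, and g and s the x- and q-gradients
  of the second function. The four Killing equations leave two of the six derivatives of \<psi>
  free; these are b1 and b2, and they cancel.\<close>

lemma bracket_identity:
  fixes a b c :: real
  assumes k: "a1 = 2 * (a * P + b * S)" "a2 = 2 * (2 * a * Q - b * P + c * S) - 2 * b1"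
    "c1 = 2 * (a * R + b * Q - 2 * c * P) - 2 * b2" "c2 = 2 * (b * R - c * Q)"
    and V: "v1 = a * U1 + b * U2" "v2 = b * U1 + c * U2"
    and q: "q1 = c * p1 - b * p2" "q2 = a * p2 - b * p1"
    and r: "r1 = 2 * (a * q1 + b * q2)" "r2 = 2 * (b * q1 + c * q2)"
  shows "(a1 * q1\<^sup>2 + 2 * b1 * q1 * q2 + c1 * q2\<^sup>2 + v1 + r1 * (c1 * p1 - b1 * p2) + r2 * (a1 * p2 - b1 * p1)) * (c * s1 - b * s2)
      - (c * r1 - b * r2) * (g1 + s1 * (c1 * p1 - b1 * p2) + s2 * (a1 * p2 - b1 * p1))
    + ((a2 * q1\<^sup>2 + 2 * b2 * q1 * q2 + c2 * q2\<^sup>2 + v2 + r1 * (c2 * p1 - b2 * p2) + r2 * (a2 * p2 - b2 * p1)) * (a * s2 - b * s1)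
      - (a * r2 - b * r1) * (g2 + s1 * (c2 * p1 - b2 * p2) + s2 * (a2 * p2 - b2 * p1)))
    = - 2 * (a * c - b\<^sup>2) * (g1 * q1 + g2 * q2
        - (P * q1\<^sup>2 + 2 * Q * q1 * q2 + R * q2\<^sup>2 + U1 / 2) * s1
        - (S * q1\<^sup>2 - 2 * P * q1 * q2 - Q * q2\<^sup>2 + U2 / 2) * s2)"
  unfolding r q k V by (simp add: algebra_simps power2_eq_square)

text \<open>The right-hand side depends on \<open>\<psi>\<close> only through the factor in front and the substitution
  \<open>q = adj \<psi> p\<close>, which is why metrics with the same \<open>\<Pi>\<close> and \<open>U\<close> share their integrals.\<close>

lemma poisson_bracket_phase_fun:
  assumes "diff_data \<psi> x" "diff_data \<kappa> x" "V differentiable (at x)" "W differentiable (at x)"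
    and k: "killing_eq T \<psi> x" and U: "potential_eq U \<psi> V x"
  shows "poisson_bracket (phase_fun \<psi> \<psi> V) (phase_fun \<psi> \<kappa> W) (x, p)
    = - 2 * (\<psi> x $ 1 $ 1 * \<psi> x $ 2 $ 2 - (\<psi> x $ 1 $ 2)\<^sup>2) * integral_form T U \<kappa> W x (adj_vec (\<psi> x) p)"
proof -
  obtain P Q R S where T: "T = (P, Q, R, S)" by (metis prod_cases4)
  let ?d = "\<lambda>i j k. partial_deriv k (\<lambda>y. \<psi> y $ i $ j) x"
  let ?a = "\<psi> x $ 1 $ 1" and ?b = "\<psi> x $ 1 $ 2" and ?c = "\<psi> x $ 2 $ 2"
  have k': "?d 1 1 1 = 2 * (?a * P + ?b * S)" "?d 1 1 2 = 2 * (2 * ?a * Q - ?b * P + ?c * S) - 2 * ?d 1 2 1"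
    "?d 2 2 1 = 2 * (?a * R + ?b * Q - 2 * ?c * P) - 2 * ?d 1 2 2" "?d 2 2 2 = 2 * (?b * R - ?c * Q)"
    using k unfolding killing_eq_def T by (simp_all add: Let_def)
  have U': "partial_deriv 1 V x = ?a * U $ 1 + ?b * U $ 2" "partial_deriv 2 V x = ?b * U $ 1 + ?c * U $ 2"
    using U by (simp_all add: potential_eq_def)
  have q: "adj_vec A r $ 1 = A $ 2 $ 2 * r $ 1 - A $ 1 $ 2 * r $ 2"
    "adj_vec A r $ 2 = A $ 1 $ 1 * r $ 2 - A $ 1 $ 2 * r $ 1" for A r
    by (simp_all add: adj_vec_def)
  have r: "quad_grad (\<psi> x) q $ 1 = 2 * (?a * q $ 1 + ?b * q $ 2)"
    "quad_grad (\<psi> x) q $ 2 = 2 * (?b * q $ 1 + ?c * q $ 2)" for q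
    by (simp_all add: quad_grad_def)
  have b: "base_grad \<psi> V x q $ i = ?d 1 1 i * (q $ 1)\<^sup>2 + 2 * ?d 1 2 i * q $ 1 * q $ 2
      + ?d 2 2 i * (q $ 2)\<^sup>2 + partial_deriv i V x" for i q
    by (simp add: base_grad_def)
  show ?thesis
    unfolding poisson_bracket_def sum_2 phase_fun_partials[OF assms(1,1,3)] phase_fun_partials[OF assms(1,2,4)]
      phase_dx_def T integral_form_def prod.case q r b
    by (rule bracket_identity[OF k' U' refl refl refl refl])
qed

section \<open>Functional independence at a point\<close>

definition phase_jet ::
  "(real^2 \<Rightarrow> real^2^2) \<Rightarrow> (real^2 \<Rightarrow> real) \<Rightarrow> real^2 \<Rightarrow> real^2 \<Rightarrow> (real^2) \<times> (real^2)" where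
  "phase_jet \<kappa> W x q = (base_grad \<kappa> W x q, quad_grad (\<kappa> x) q)"

definition indep3 :: "'v::real_vector \<Rightarrow> 'v \<Rightarrow> 'v \<Rightarrow> bool" where
  "indep3 u v w \<longleftrightarrow> (\<forall>a b c. a *\<^sub>R u + b *\<^sub>R v + c *\<^sub>R w = 0 \<longrightarrow> a = 0 \<and> b = 0 \<and> c = 0)"

text \<open>The substitution (x, p) to (x, q) is invertible where det \<psi> is nonzero, so
  differentials may be compared in the coordinates (x, q), where they are the jets and \<psi> no
  longer appears.\<close>

lemma differentials_indep_phase_fun:
  assumes "diff_data \<psi> x" "diff_data \<kappa>\<^sub>1 x" "diff_data \<kappa>\<^sub>2 x" "diff_data \<kappa>\<^sub>3 x"
    and "W\<^sub>1 differentiable (at x)" "W\<^sub>2 differentiable (at x)" "W\<^sub>3 differentiable (at x)"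
    and det: "\<psi> x $ 1 $ 1 * \<psi> x $ 2 $ 2 - (\<psi> x $ 1 $ 2)\<^sup>2 \<noteq> 0"
  shows "differentials_indep_at (phase_fun \<psi> \<kappa>\<^sub>1 W\<^sub>1) (phase_fun \<psi> \<kappa>\<^sub>2 W\<^sub>2) (phase_fun \<psi> \<kappa>\<^sub>3 W\<^sub>3) (x, p)
    \<longleftrightarrow> indep3 (phase_jet \<kappa>\<^sub>1 W\<^sub>1 x (adj_vec (\<psi> x) p)) (phase_jet \<kappa>\<^sub>2 W\<^sub>2 x (adj_vec (\<psi> x) p))
         (phase_jet \<kappa>\<^sub>3 W\<^sub>3 x (adj_vec (\<psi> x) p))"
proof -
  define l1 where "l1 i = partial_deriv i (\<lambda>y. \<psi> y $ 2 $ 2) x * p $ 1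
    - partial_deriv i (\<lambda>y. \<psi> y $ 1 $ 2) x * p $ 2" for i
  define l2 where "l2 i = partial_deriv i (\<lambda>y. \<psi> y $ 1 $ 1) x * p $ 2
    - partial_deriv i (\<lambda>y. \<psi> y $ 1 $ 2) x * p $ 1" for i
  \<comment> \<open>\<open>\<Lambda> j\<close> is the pullback of the covector j under (x, p) to (x,
    adj \<psi> p); \<open>l1 i\<close> and \<open>l2 i\<close> are the derivatives of the two
    components of q in the i-th coordinate of x.\<close>
  define \<Lambda> where "\<Lambda> j v = fst v $ 1 * (fst j $ 1 + snd j $ 1 * l1 1 + snd j $ 2 * l2 1)
    + fst v $ 2 * (fst j $ 2 + snd j $ 1 * l1 2 + snd j $ 2 * l2 2)
    + ((\<psi> x $ 2 $ 2 * snd j $ 1 - \<psi> x $ 1 $ 2 * snd j $ 2) * snd v $ 1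
      + (\<psi> x $ 1 $ 1 * snd j $ 2 - \<psi> x $ 1 $ 2 * snd j $ 1) * snd v $ 2)"
    for j v :: "(real^2) \<times> (real^2)"
  have D: "frechet_derivative (phase_fun \<psi> \<kappa> W) (at (x, p)) v
      = \<Lambda> (phase_jet \<kappa> W x (adj_vec (\<psi> x) p)) v"
    if "diff_data \<kappa> x" "W differentiable (at x)" for \<kappa> W v
    unfolding frechet_derivative_at[OF phase_fun_has_derivative[OF assms(1) that, of p], symmetric]
    by (simp add: \<Lambda>_def phase_jet_def phase_dx_def l1_def l2_def inner_vec_def sum_2) (simp add: adj_vec_def)
  have lin: "\<Lambda> (a *\<^sub>R i + b *\<^sub>R j + c *\<^sub>R k) v = a * \<Lambda> i v + b * \<Lambda> j v + c * \<Lambda> k v" for a b c i j k v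
    by (simp add: \<Lambda>_def algebra_simps)
  have inj: "j = 0" if "\<forall>v. \<Lambda> j v = 0" for j
  proof -
    let ?a = "\<psi> x $ 1 $ 1" and ?b = "\<psi> x $ 1 $ 2" and ?c = "\<psi> x $ 2 $ 2"
    have e: "?c * snd j $ 1 - ?b * snd j $ 2 = 0" "?a * snd j $ 2 - ?b * snd j $ 1 = 0"
      using that[rule_format, of "(0, axis 1 1)"] that[rule_format, of "(0, axis 2 1)"]
      by (simp_all add: \<Lambda>_def axis_def)
    have "(?a * ?c - ?b\<^sup>2) * snd j $ 1
        = ?a * (?c * snd j $ 1 - ?b * snd j $ 2) + ?b * (?a * snd j $ 2 - ?b * snd j $ 1)"
      "(?a * ?c - ?b\<^sup>2) * snd j $ 2
        = ?b * (?c * snd j $ 1 - ?b * snd j $ 2) + ?c * (?a * snd j $ 2 - ?b * snd j $ 1)"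
      by (simp_all add: algebra_simps power2_eq_square)
    then have s: "snd j $ 1 = 0" "snd j $ 2 = 0"
      unfolding e using det by (simp_all only: mult_zero_right add_0_left mult_eq_0_iff simp_thms)
    have "fst j $ 1 = 0" "fst j $ 2 = 0"
      using that[rule_format, of "(axis 1 1, 0)"] that[rule_format, of "(axis 2 1, 0)"] s
      by (simp_all add: \<Lambda>_def axis_def)
    with s show "j = 0" by (simp add: prod_eq_iff vec_eq_iff forall_2)
  qed
  have zero: "\<Lambda> 0 v = 0" for v by (simp add: \<Lambda>_def)
  show ?thesis
    unfolding differentials_indep_at_def indep3_def D[OF assms(2,5)] D[OF assms(3,6)] D[OF assms(4,7)] lin[symmetric]
    by (metis inj zero)
qed

text \<open>If b = x u + y v + z w, a dependence at s forces x + y s + z s^2 = 0, and this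
  polynomial is nonzero because b is. The shears by s and s^2 make its coefficients exactly those of
  b. If b lies outside the span, every s is good, as the sheared pair stays independent inside the
  span.\<close>

lemma finite_dependent_shears:
  fixes u v w b :: "'v::real_vector"
  assumes ind: "indep3 u v w" and "b \<noteq> 0"
  shows "finite {s. \<not> indep3 b (v - s *\<^sub>R u) (w - s\<^sup>2 *\<^sub>R u)}"
proof (cases "\<exists>x y z. b = x *\<^sub>R u + y *\<^sub>R v + z *\<^sub>R w")
  case True
  then obtain x y z where b: "b = x *\<^sub>R u + y *\<^sub>R v + z *\<^sub>R w" by blast
  with \<open>b \<noteq> 0\<close> have "[:x, y, z:] \<noteq> 0" by auto
  moreover have "poly [:x, y, z:] s = 0"
    if dep: "\<not> indep3 b (v - s *\<^sub>R u) (w - s\<^sup>2 *\<^sub>R u)" for s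
  proof -
    obtain c1 c2 c3 where c: "c1 *\<^sub>R b + c2 *\<^sub>R (v - s *\<^sub>R u) + c3 *\<^sub>R (w - s\<^sup>2 *\<^sub>R u) = 0"
      and n: "\<not> (c1 = 0 \<and> c2 = 0 \<and> c3 = 0)"
      using dep unfolding indep3_def by blast
    have "(c1 * x - c2 * s - c3 * s\<^sup>2) *\<^sub>R u + (c1 * y + c2) *\<^sub>R v + (c1 * z + c3) *\<^sub>R w = 0"
      using c unfolding b by (simp add: algebra_simps)
    then have z: "c1 * x - c2 * s - c3 * s\<^sup>2 = 0" "c1 * y + c2 = 0" "c1 * z + c3 = 0"
      using ind unfolding indep3_def by blast+
    have "c1 \<noteq> 0" using n z by auto
    moreover have "c1 * (x + y * s + z * s\<^sup>2) = 0"
    proof -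
      have "c2 = - (c1 * y)" "c3 = - (c1 * z)" using z by linarith+
      then show ?thesis using z(1) by (simp add: algebra_simps)
    qed
    ultimately have "x + y * s + z * s\<^sup>2 = 0" by simp
    then show ?thesis by (simp add: algebra_simps power2_eq_square)
  qed
  ultimately show ?thesis
    by (intro finite_subset[OF _ poly_roots_finite[of "[:x, y, z:]"]]) auto
next
  case False
  have "indep3 b (v - s *\<^sub>R u) (w - s\<^sup>2 *\<^sub>R u)" for s
    unfolding indep3_def
  proof (intro allI impI)
    fix c1 c2 c3 assume c: "c1 *\<^sub>R b + c2 *\<^sub>R (v - s *\<^sub>R u) + c3 *\<^sub>R (w - s\<^sup>2 *\<^sub>R u) = 0"
    have eq: "c1 *\<^sub>R b = (c2 * s + c3 * s\<^sup>2) *\<^sub>R u + (- c2) *\<^sub>R v + (- c3) *\<^sub>R w"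
      using c by (simp add: algebra_simps add_eq_0_iff)
    have c1: "c1 = 0"
    proof (rule ccontr)
      assume "c1 \<noteq> 0"
      then have "b = inverse c1 *\<^sub>R (c1 *\<^sub>R b)" by simp
      also have "\<dots> = (inverse c1 * (c2 * s + c3 * s\<^sup>2)) *\<^sub>R u + (inverse c1 * (- c2)) *\<^sub>R v + (inverse c1 * (- c3)) *\<^sub>R w"
        unfolding eq by (simp only: scaleR_add_right scaleR_scaleR)
      finally show False using False by blast
    qed
    have "(- (c2 * s) - c3 * s\<^sup>2) *\<^sub>R u + c2 *\<^sub>R v + c3 *\<^sub>R w = 0"
      using c c1 by (simp add: algebra_simps)
    with ind c1 show "c1 = 0 \<and> c2 = 0 \<and> c3 = 0" unfolding indep3_def by blast
  qed
  then show ?thesis by simp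
qed

section \<open>Superintegrability in projective terms\<close>

lemma smooth_on_matrix_mult:
  fixes A B :: "'a::real_normed_vector \<Rightarrow> real^2^2"
  assumes "open S" "smooth_on S A" "smooth_on S B"
  shows "smooth_on S (\<lambda>x. A x ** B x)"
  by (rule smooth_on_matrixI[OF assms(1)])
     (simp add: matrix_matrix_mult_def sum_2, intro smooth_on_intros smooth_on_nth assms)

lemma smooth_on_scaleR_matrix:
  fixes A :: "'a::real_normed_vector \<Rightarrow> real^2^2"
  assumes "open S" "smooth_on S f" "smooth_on S A"
  shows "smooth_on S (\<lambda>x. f x *\<^sub>R A x)"
  by (rule smooth_on_matrixI[OF assms(1)])
     (simp, intro smooth_on_intros smooth_on_nth assms)

lemma smooth_on_adj2:
  fixes A :: "'a::real_normed_vector \<Rightarrow> real^2^2"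
  assumes "open S" "smooth_on S A"
  shows "smooth_on S (\<lambda>x. adj2 (A x))"
proof (rule smooth_on_matrixI[OF assms(1)])
  fix i j :: 2
  show "smooth_on S (\<lambda>x. adj2 (A x) $ i $ j)"
    using exhaust_2[of i] exhaust_2[of j]
    by (elim disjE; simp add: adj2_nth; intro smooth_on_uminus smooth_on_nth assms)
qed

lemma smooth_on_diff_data:
  "open S \<Longrightarrow> smooth_on S \<kappa> \<Longrightarrow> x \<in> S \<Longrightarrow> diff_data \<kappa> x"
  unfolding diff_data_def by (intro allI smooth_on_differentiable smooth_on_nth)

lemma det_scaleR_2: "det (c *\<^sub>R A :: real^2^2) = c\<^sup>2 * det A"
  by (simp add: det_2 algebra_simps power2_eq_square)

lemma transpose_scaleR: "transpose (c *\<^sub>R A :: real^'n^'m) = c *\<^sub>R transpose A"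
  by (simp add: transpose_def vec_eq_iff)

lemma transpose_add: "transpose (A + B :: real^'n^'m) = transpose A + transpose B"
  by (simp add: transpose_def vec_eq_iff)

lemma det_symmetric_2:
  fixes A :: "real^2^2"
  assumes "transpose A = A"
  shows "det A = A $ 1 $ 1 * A $ 2 $ 2 - (A $ 1 $ 2)\<^sup>2"
  by (simp add: det_2 power2_eq_square symmetric_matrix_nth[OF assms, of 2 1])

lemma adj2_mult: "adj2 A ** A = det A *\<^sub>R mat 1" "A ** adj2 A = det A *\<^sub>R mat 1"
  by (simp_all add: vec_eq_iff forall_2 matrix_matrix_mult_def sum_2 adj2_nth mat_def det_2)

lemma transpose_adj2:
  assumes "transpose A = A"
  shows "transpose (adj2 A) = adj2 A"
  by (simp add: vec_eq_iff forall_2 transpose_def adj2_nth symmetric_matrix_nth[OF assms, of 2 1])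

section \<open>Passing between metrics, contravariant tensors and their weighted forms\<close>

lemma metric_on_weighted:
  assumes "open M" "metric_on M g"
  shows "metric_on M (weighted g)"
  unfolding metric_on_def
proof (intro conjI ballI)
  have g: "smooth_on M g" "\<And>x. x \<in> M \<Longrightarrow> det (g x) \<noteq> 0" "\<And>x. x \<in> M \<Longrightarrow> transpose (g x) = g x"
    using assms(2) by (auto simp: metric_on_def)
  show "smooth_on M (weighted g)"
    unfolding weighted_def[abs_def]
    by (intro smooth_on_scaleR_matrix smooth_on_inverse smooth_on_abs_powr smooth_on_det_2 assms(1) g)
       (use g(2) in auto)
  fix x assume "x \<in> M"
  then show "transpose (weighted g x) = weighted g x" "det (weighted g x) \<noteq> 0"
    using g by (simp_all add: weighted_def transpose_scaleR det_scaleR_2)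
qed

text \<open>In dimension 2, det \<psi> = det g |det g|^(-4/3), so (det \<psi>)^2 = |det g|^(-2/3)
  undoes the weight. This is the origin of the squared determinant in
  \<open>metric_family\<close>.\<close>

lemma weighted_inverse:
  assumes "det (g x) \<noteq> 0"
  shows "g x = weighted g x /\<^sub>R (det (weighted g x))\<^sup>2"
proof -
  let ?e = "\<bar>det (g x)\<bar> powr (2/3)"
  have e: "?e > 0" using assms by simp
  have "?e ^ 3 = \<bar>det (g x)\<bar> powr 2" using assms by (simp add: powr_power)
  also have "\<dots> = (det (g x))\<^sup>2" using assms by simp
  finally have "?e ^ 3 = (det (g x))\<^sup>2" .
  then have "(det (weighted g x))\<^sup>2 = inverse ?e"
    using e by (simp add: weighted_def det_scaleR_2 power_mult_distrib power_inverse[symmetric]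
        field_simps power2_eq_square power3_eq_cube)
  then show ?thesis using e by (simp add: weighted_def)
qed

text \<open>Lowering the index of U with \<psi> cancels both the power of the determinant and the
  inverse metric, leaving dV.\<close>

lemma potential_eq_weighted:
  assumes "metric_on M g" "x \<in> M"
  shows "potential_eq (proj_vector_potential g V x) (weighted g) V x"
proof -
  have d: "det (g x) \<noteq> 0" using assms by (auto simp: metric_on_def)
  have inv: "g x ** matrix_inv (g x) = mat 1"
    using d by (simp add: matrix_inv_2 matrix_scalar_ac scalar_matrix_assoc[symmetric] adj2_mult)
  have "weighted g x *v proj_vector_potential g V x = (g x ** matrix_inv (g x)) *v (\<chi> i. partial_deriv i V x)"
    using d by (simp add: weighted_def proj_vector_potential_def gradient_def matrix_vector_mul_assoc
        scalar_matrix_assoc[symmetric] scaleR_matrix_vector_assoc[symmetric] matrix_vector_mult_scaleR)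
  then have eq: "weighted g x *v proj_vector_potential g V x = (\<chi> i. partial_deriv i V x)"
    by (simp add: inv)
  have sym: "weighted g x $ 2 $ 1 = weighted g x $ 1 $ 2"
    using metric_on_symmetric[OF assms] by (simp add: weighted_def)
  have "partial_deriv i V x = (weighted g x *v proj_vector_potential g V x) $ i" for i
    unfolding eq by simp
  then show ?thesis
    by (simp add: potential_eq_def matrix_vector_mult_def sum_2 sym)
qed

text \<open>Both sides equal det \<psi> times adj \<psi> evaluated on p: the left because the
  inverse of g is det \<psi> adj \<psi>, the right because adj \<psi> \<psi> adj \<psi> = det \<psi>
  adj \<psi>.\<close>

lemma natural_hamiltonian_phase_fun:
  assumes "transpose (\<psi> x) = \<psi> x" "det (\<psi> x) \<noteq> 0" "g x = \<psi> x /\<^sub>R (det (\<psi> x))\<^sup>2"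
  shows "natural_hamiltonian g V (x, p) = phase_fun \<psi> \<psi> V (x, p)"
proof -
  have sym: "\<psi> x $ 2 $ 1 = \<psi> x $ 1 $ 2" by (rule symmetric_matrix_nth[OF assms(1)])
  have dg: "det (g x) = inverse (det (\<psi> x)) ^ 3"
    using assms(2) by (simp add: assms(3) det_scaleR_2 field_simps power2_eq_square power3_eq_cube)
  have "adj2 (g x) = adj2 (\<psi> x) /\<^sub>R (det (\<psi> x))\<^sup>2"
    by (simp add: assms(3) vec_eq_iff forall_2 adj2_nth)
  moreover have "matrix_inv (g x) = adj2 (g x) /\<^sub>R det (g x)"
    using assms(2) dg by (intro matrix_inv_2) simp
  ultimately have "matrix_inv (g x) = (det (\<psi> x) ^ 3 * inverse ((det (\<psi> x))\<^sup>2)) *\<^sub>R adj2 (\<psi> x)"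
    by (simp add: dg power_inverse)
  also have "det (\<psi> x) ^ 3 * inverse ((det (\<psi> x))\<^sup>2) = det (\<psi> x)"
    using assms(2) by (simp add: field_simps power2_eq_square power3_eq_cube)
  finally have inv: "matrix_inv (g x) = det (\<psi> x) *\<^sub>R adj2 (\<psi> x)" .
  show ?thesis
    by (simp add: natural_hamiltonian_def quad_plus_pot_def inv sum_2 adj2_nth phase_fun_def quad_form_def
        adj_vec_def sym det_symmetric_2[OF assms(1)])
       (simp add: algebra_simps power2_eq_square)
qed

lemma quad_plus_pot_phase_fun:
  assumes "transpose (\<psi> x) = \<psi> x" "transpose (\<kappa> x) = \<kappa> x" "K x = adj2 (\<psi> x) ** \<kappa> x ** adj2 (\<psi> x)"
  shows "quad_plus_pot K W (x, p) = phase_fun \<psi> \<kappa> W (x, p)"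
proof -
  have sym: "\<psi> x $ 2 $ 1 = \<psi> x $ 1 $ 2" "\<kappa> x $ 2 $ 1 = \<kappa> x $ 1 $ 2"
    by (rule symmetric_matrix_nth; rule assms)+
  show ?thesis
    by (simp add: quad_plus_pot_def assms(3) matrix_matrix_mult_def sum_2 adj2_nth phase_fun_def quad_form_def
        adj_vec_def sym)
       (simp add: algebra_simps power2_eq_square)
qed

text \<open>Every K arises from some \<kappa>, given explicitly and smoothly in the entries.\<close>

lemma adj2_sandwich:
  fixes A K :: "real^2^2"
  assumes "det A \<noteq> 0"
  shows "adj2 A ** ((A ** K ** A) /\<^sub>R (det A)\<^sup>2) ** adj2 A = K"
proof -
  have "adj2 A ** (A ** K ** A) ** adj2 A = (adj2 A ** A) ** K ** (A ** adj2 A)"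
    by (simp add: matrix_mul_assoc)
  also have "\<dots> = (det A)\<^sup>2 *\<^sub>R K"
    by (simp add: adj2_mult matrix_scalar_ac scalar_matrix_assoc[symmetric] power2_eq_square)
  finally show ?thesis
    using assms by (simp add: matrix_scalar_ac scalar_matrix_assoc[symmetric])
qed

text \<open>An explicit preimage shows that the fibre substitution is onto, so a condition for all p
  can be read as one for all q.\<close>

lemma adj_vec_surj:
  assumes "transpose A = A" "det A \<noteq> 0"
  shows "adj_vec A ((A *v q) /\<^sub>R det A) = q"
proof -
  have sym: "A $ 2 $ 1 = A $ 1 $ 2" by (rule symmetric_matrix_nth[OF assms(1)])
  have "adj_vec A (A *v q) = det A *\<^sub>R q"
    unfolding det_symmetric_2[OF assms(1)]
    by (simp add: vec_eq_iff forall_2 adj_vec_def matrix_vector_mult_def sum_2 sym algebra_simps power2_eq_square)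
  moreover have "adj_vec A (c *\<^sub>R r) = c *\<^sub>R adj_vec A r" for c r
    by (simp add: vec_eq_iff forall_2 adj_vec_def algebra_simps)
  ultimately show ?thesis using assms(2) by simp
qed

section \<open>Criteria for integrals and for functional independence\<close>

lemma poisson_bracket_cong:
  assumes "open N" "z \<in> N" "\<And>w. w \<in> N \<Longrightarrow> F w = F' w" "\<And>w. w \<in> N \<Longrightarrow> G w = G' w"
    and "F' differentiable (at z)" "G' differentiable (at z)"
  shows "poisson_bracket F G z = poisson_bracket F' G' z"
  unfolding poisson_bracket_def
  using frechet_derivative_transform_within_open[of F' z N F]
    frechet_derivative_transform_within_open[of G' z N G] assms by simp

lemma differentials_indep_at_cong:
  assumes "open N" "z \<in> N" "\<And>w. w \<in> N \<Longrightarrow> F w = F' w" "\<And>w. w \<in> N \<Longrightarrow> G w = G' w"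
    "\<And>w. w \<in> N \<Longrightarrow> H w = H' w"
    and "F' differentiable (at z)" "G' differentiable (at z)" "H' differentiable (at z)"
  shows "differentials_indep_at F G H z = differentials_indep_at F' G' H' z"
  unfolding differentials_indep_at_def
  using frechet_derivative_transform_within_open[of F' z N F]
    frechet_derivative_transform_within_open[of G' z N G]
    frechet_derivative_transform_within_open[of H' z N H] assms by simp

lemma phase_fun_differentiable:
  "diff_data \<psi> x \<Longrightarrow> diff_data \<kappa> x \<Longrightarrow> W differentiable (at x) \<Longrightarrow> phase_fun \<psi> \<kappa> W differentiable (at (x, p))"
  using phase_fun_has_derivative unfolding differentiable_def by blast

definition sym_smooth :: "(real^2) set \<Rightarrow> (real^2 \<Rightarrow> real^2^2) \<Rightarrow> bool" where
  "sym_smooth N \<kappa> \<longleftrightarrow> smooth_on N \<kappa> \<and> (\<forall>x\<in>N. transpose (\<kappa> x) = \<kappa> x)"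

definition jets_indep where
  "jets_indep \<psi> V \<kappa>\<^sub>1 W\<^sub>1 \<kappa>\<^sub>2 W\<^sub>2 x q
    \<longleftrightarrow> indep3 (phase_jet \<psi> V x q) (phase_jet \<kappa>\<^sub>1 W\<^sub>1 x q) (phase_jet \<kappa>\<^sub>2 W\<^sub>2 x q)"

text \<open>In the bracket formula \<psi> contributes a nonzero factor and a surjective fibre
  substitution; removing both leaves a condition on T, U, \<kappa> and W alone.\<close>

lemma quadratic_integral_iff_integral_form:
  assumes N: "open N" and \<psi>: "metric_on N \<psi>" and V: "smooth_on N V"
    and g: "\<And>x. x \<in> N \<Longrightarrow> g x = \<psi> x /\<^sub>R (det (\<psi> x))\<^sup>2"
    and T: "\<And>x. x \<in> N \<Longrightarrow> killing_eq (T x) \<psi> x" and U: "\<And>x. x \<in> N \<Longrightarrow> potential_eq (U x) \<psi> V x"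
    and \<kappa>: "sym_smooth N \<kappa>" and W: "smooth_on N W"
    and K: "\<And>x. x \<in> N \<Longrightarrow> K x = adj2 (\<psi> x) ** \<kappa> x ** adj2 (\<psi> x)" "sym_smooth N K"
  shows "quadratic_integral N (natural_hamiltonian g V) K W
    \<longleftrightarrow> (\<forall>x\<in>N. \<forall>q. integral_form (T x) (U x) \<kappa> W x q = 0)"
proof -
  have N': "open (N \<times> (UNIV :: (real^2) set))" using N by (intro open_Times) auto
  have \<psi>': "smooth_on N \<psi>" "\<And>x. x \<in> N \<Longrightarrow> transpose (\<psi> x) = \<psi> x" "\<And>x. x \<in> N \<Longrightarrow> det (\<psi> x) \<noteq> 0"
    using \<psi> by (auto simp: metric_on_def)
  have \<kappa>': "smooth_on N \<kappa>" "\<And>x. x \<in> N \<Longrightarrow> transpose (\<kappa> x) = \<kappa> x"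
    using \<kappa> by (auto simp: sym_smooth_def)
  have br: "poisson_bracket (natural_hamiltonian g V) (quad_plus_pot K W) (x, p)
      = - 2 * det (\<psi> x) * integral_form (T x) (U x) \<kappa> W x (adj_vec (\<psi> x) p)" if x: "x \<in> N" for x p
  proof -
    note d = smooth_on_diff_data[OF N \<psi>'(1) x] smooth_on_diff_data[OF N \<kappa>'(1) x]
      smooth_on_differentiable[OF V x] smooth_on_differentiable[OF W x]
    have "poisson_bracket (natural_hamiltonian g V) (quad_plus_pot K W) (x, p)
        = poisson_bracket (phase_fun \<psi> \<psi> V) (phase_fun \<psi> \<kappa> W) (x, p)"
      using x by (intro poisson_bracket_cong[OF N'])
        (auto intro!: natural_hamiltonian_phase_fun quad_plus_pot_phase_fun phase_fun_differentiable d
          simp: \<psi>' \<kappa>' g K)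
    also have "\<dots> = - 2 * det (\<psi> x) * integral_form (T x) (U x) \<kappa> W x (adj_vec (\<psi> x) p)"
      unfolding det_symmetric_2[OF \<psi>'(2)[OF x]]
      by (rule poisson_bracket_phase_fun[OF d T[OF x] U[OF x]])
    finally show ?thesis .
  qed
  have "(\<forall>p. poisson_bracket (natural_hamiltonian g V) (quad_plus_pot K W) (x, p) = 0)
      \<longleftrightarrow> (\<forall>q. integral_form (T x) (U x) \<kappa> W x q = 0)" if x: "x \<in> N" for x
    using \<psi>'(3)[OF x] adj_vec_surj[OF \<psi>'(2,3)[OF x]] by (simp add: br[OF x]) metis
  then show ?thesis
    using K(2) W unfolding quadratic_integral_def sym_smooth_def by auto
qed

text \<open>The metric still enters through q = adj \<psi> p, so carrying the density over to
  another metric requires \<open>dense_change_of_metric\<close>.\<close>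

lemma functionally_independent_iff_jets:
  assumes N: "open N" and \<psi>: "metric_on N \<psi>" and V: "smooth_on N V"
    and g: "\<And>x. x \<in> N \<Longrightarrow> g x = \<psi> x /\<^sub>R (det (\<psi> x))\<^sup>2"
    and \<kappa>: "sym_smooth N \<kappa>\<^sub>1" "sym_smooth N \<kappa>\<^sub>2" and W: "smooth_on N W\<^sub>1" "smooth_on N W\<^sub>2"
    and K: "\<And>x. x \<in> N \<Longrightarrow> K\<^sub>1 x = adj2 (\<psi> x) ** \<kappa>\<^sub>1 x ** adj2 (\<psi> x)"
      "\<And>x. x \<in> N \<Longrightarrow> K\<^sub>2 x = adj2 (\<psi> x) ** \<kappa>\<^sub>2 x ** adj2 (\<psi> x)"
  shows "functionally_independent_on (N \<times> UNIV) (natural_hamiltonian g V)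
      (quad_plus_pot K\<^sub>1 W\<^sub>1) (quad_plus_pot K\<^sub>2 W\<^sub>2)
    \<longleftrightarrow> N \<times> UNIV \<subseteq> closure {(x, p). x \<in> N \<and> jets_indep \<psi> V \<kappa>\<^sub>1 W\<^sub>1 \<kappa>\<^sub>2 W\<^sub>2 x (adj_vec (\<psi> x) p)}"
proof -
  have N': "open (N \<times> (UNIV :: (real^2) set))" using N by (intro open_Times) auto
  have \<psi>': "smooth_on N \<psi>" "\<And>x. x \<in> N \<Longrightarrow> transpose (\<psi> x) = \<psi> x" "\<And>x. x \<in> N \<Longrightarrow> det (\<psi> x) \<noteq> 0"
    using \<psi> by (auto simp: metric_on_def)
  have \<kappa>': "smooth_on N \<kappa>\<^sub>1" "\<And>x. x \<in> N \<Longrightarrow> transpose (\<kappa>\<^sub>1 x) = \<kappa>\<^sub>1 x"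
    "smooth_on N \<kappa>\<^sub>2" "\<And>x. x \<in> N \<Longrightarrow> transpose (\<kappa>\<^sub>2 x) = \<kappa>\<^sub>2 x"
    using \<kappa> by (auto simp: sym_smooth_def)
  have "differentials_indep_at (natural_hamiltonian g V) (quad_plus_pot K\<^sub>1 W\<^sub>1) (quad_plus_pot K\<^sub>2 W\<^sub>2) (x, p)
      \<longleftrightarrow> jets_indep \<psi> V \<kappa>\<^sub>1 W\<^sub>1 \<kappa>\<^sub>2 W\<^sub>2 x (adj_vec (\<psi> x) p)" if x: "x \<in> N" for x p
  proof -
    note d = smooth_on_diff_data[OF N \<psi>'(1) x] smooth_on_diff_data[OF N \<kappa>'(1) x]
      smooth_on_diff_data[OF N \<kappa>'(3) x]
    note d' = smooth_on_differentiable[OF V x] smooth_on_differentiable[OF W(1) x]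
      smooth_on_differentiable[OF W(2) x]
    have "differentials_indep_at (natural_hamiltonian g V) (quad_plus_pot K\<^sub>1 W\<^sub>1) (quad_plus_pot K\<^sub>2 W\<^sub>2) (x, p)
        \<longleftrightarrow> differentials_indep_at (phase_fun \<psi> \<psi> V) (phase_fun \<psi> \<kappa>\<^sub>1 W\<^sub>1) (phase_fun \<psi> \<kappa>\<^sub>2 W\<^sub>2) (x, p)"
      using x by (intro differentials_indep_at_cong[OF N'])
        (auto intro!: natural_hamiltonian_phase_fun quad_plus_pot_phase_fun phase_fun_differentiable d d'
          simp: \<psi>' \<kappa>' g K)
    then show ?thesis
      unfolding jets_indep_def
      using differentials_indep_phase_fun[OF d(1,1,2,3) d'] \<psi>'(3)[OF x]
      unfolding det_symmetric_2[OF \<psi>'(2)[OF x]] by simp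
  qed
  then have "{z \<in> N \<times> UNIV. differentials_indep_at (natural_hamiltonian g V) (quad_plus_pot K\<^sub>1 W\<^sub>1) (quad_plus_pot K\<^sub>2 W\<^sub>2) z}
      = {(x, p). x \<in> N \<and> jets_indep \<psi> V \<kappa>\<^sub>1 W\<^sub>1 \<kappa>\<^sub>2 W\<^sub>2 x (adj_vec (\<psi> x) p)}"
    by auto
  then show ?thesis by (simp add: functionally_independent_on_def)
qed

section \<open>Linearity of the equations and of the jets\<close>

lemma partial_deriv_add_scaled:
  assumes "f differentiable (at x)" "g differentiable (at x)"
  shows "partial_deriv i (\<lambda>y. f y + c * g y) x = partial_deriv i f x + c * partial_deriv i g x"
proof -
  have "((\<lambda>y. f y + c * g y) has_derivative
      (\<lambda>v. frechet_derivative f (at x) v + c * frechet_derivative g (at x) v)) (at x)"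
    using assms frechet_derivative_works by (intro derivative_intros) blast+
  from partial_derivI[OF this] show ?thesis by (simp add: partial_deriv_def)
qed

lemma quad_grad_add_scaled: "quad_grad (A + c *\<^sub>R B) q = quad_grad A q + c *\<^sub>R quad_grad B q"
  by (simp add: quad_grad_def vec_eq_iff forall_2 algebra_simps)

context
  fixes \<kappa> \<psi> :: "real^2 \<Rightarrow> real^2^2" and W V :: "real^2 \<Rightarrow> real" and x :: "real^2"
  assumes diff: "diff_data \<kappa> x" "diff_data \<psi> x" "W differentiable (at x)" "V differentiable (at x)"
begin

lemma base_grad_add_scaled:
  "base_grad (\<lambda>y. \<kappa> y + c *\<^sub>R \<psi> y) (\<lambda>y. W y + c * V y) x q = base_grad \<kappa> W x q + c *\<^sub>R base_grad \<psi> V x q"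
  using diff
  by (simp add: base_grad_def vec_eq_iff partial_deriv_add_scaled diff_data_def algebra_simps)

lemma phase_jet_add_scaled:
  "phase_jet (\<lambda>y. \<kappa> y + c *\<^sub>R \<psi> y) (\<lambda>y. W y + c * V y) x q = phase_jet \<kappa> W x q + c *\<^sub>R phase_jet \<psi> V x q"
  by (simp add: phase_jet_def base_grad_add_scaled quad_grad_add_scaled)

lemma integral_form_add_scaled:
  "integral_form T U (\<lambda>y. \<kappa> y + c *\<^sub>R \<psi> y) (\<lambda>y. W y + c * V y) x q
    = integral_form T U \<kappa> W x q + c * integral_form T U \<psi> V x q"
  unfolding integral_form_def base_grad_add_scaled quad_grad_add_scaled
  by (simp add: algebra_simps split: prod.split)

lemma killing_eq_add_scaled:
  "killing_eq T \<kappa> x \<Longrightarrow> killing_eq T \<psi> x \<Longrightarrow> killing_eq T (\<lambda>y. \<kappa> y + c *\<^sub>R \<psi> y) x"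
proof -
  have pd: "partial_deriv k (\<lambda>y. (\<kappa> y + c *\<^sub>R \<psi> y) $ i $ j) x
      = partial_deriv k (\<lambda>y. \<kappa> y $ i $ j) x + c * partial_deriv k (\<lambda>y. \<psi> y $ i $ j) x" for i j k
    using partial_deriv_add_scaled[of "\<lambda>y. \<kappa> y $ i $ j" x "\<lambda>y. \<psi> y $ i $ j"] diff by (simp add: diff_data_def)
  obtain P Q R S where T: "T = (P, Q, R, S)" by (metis prod_cases4)
  assume a: "killing_eq T \<kappa> x" and b: "killing_eq T \<psi> x"
  note a' = a[unfolded killing_eq_def T prod.case Let_def]
  note b' = b[unfolded killing_eq_def T prod.case Let_def]
  show ?thesis
    unfolding killing_eq_def T prod.case Let_def pd
    using a' b'[THEN conjunct1, THEN arg_cong[where f = "\<lambda>r. c * r"]]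
      b'[THEN conjunct2, THEN conjunct1, THEN arg_cong[where f = "\<lambda>r. c * r"]]
      b'[THEN conjunct2, THEN conjunct2, THEN conjunct1, THEN arg_cong[where f = "\<lambda>r. c * r"]]
      b'[THEN conjunct2, THEN conjunct2, THEN conjunct2, THEN arg_cong[where f = "\<lambda>r. c * r"]]
    by (simp add: algebra_simps)
qed

lemma potential_eq_add_scaled:
  "potential_eq U \<kappa> W x \<Longrightarrow> potential_eq U \<psi> V x
    \<Longrightarrow> potential_eq U (\<lambda>y. \<kappa> y + c *\<^sub>R \<psi> y) (\<lambda>y. W y + c * V y) x"
  using diff by (simp add: potential_eq_def partial_deriv_add_scaled algebra_simps)

end

lemma sym_smooth_add_scaled:
  assumes "open N" "sym_smooth N \<kappa>" "sym_smooth N \<psi>"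
  shows "sym_smooth N (\<lambda>y. \<kappa> y + c *\<^sub>R \<psi> y)"
  using assms
  by (auto simp: sym_smooth_def transpose_add transpose_scaleR
      intro!: smooth_on_add smooth_on_scaleR_matrix smooth_on_const)

lemma sym_smooth_sandwich:
  assumes "open N" "sym_smooth N A" "sym_smooth N B"
  shows "sym_smooth N (\<lambda>x. A x ** B x ** A x)"
  using assms
  by (auto simp: sym_smooth_def matrix_transpose_mul matrix_mul_assoc intro!: smooth_on_matrix_mult)

lemma sym_smooth_subset: "sym_smooth M \<kappa> \<Longrightarrow> N \<subseteq> M \<Longrightarrow> sym_smooth N \<kappa>"
  using smooth_on_subset by (auto simp: sym_smooth_def)

lemma sym_smooth_metric_on: "metric_on N \<psi> \<Longrightarrow> sym_smooth N \<psi>"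
  by (auto simp: sym_smooth_def metric_on_def)

lemma sym_smooth_adj2: "open N \<Longrightarrow> sym_smooth N A \<Longrightarrow> sym_smooth N (\<lambda>x. adj2 (A x))"
  by (auto simp: sym_smooth_def smooth_on_adj2 transpose_adj2)

section \<open>Fibre substitutions and dense subsets of phase space\<close>

lemma mult_adj_vec:
  assumes "transpose A = A"
  shows "A *v adj_vec A p = det A *\<^sub>R p"
  unfolding det_symmetric_2[OF assms]
  by (simp add: vec_eq_iff forall_2 adj_vec_def matrix_vector_mult_def sum_2
      symmetric_matrix_nth[OF assms, of 2 1] algebra_simps power2_eq_square)

lemma quad_grad_nonzero:
  assumes "transpose A = A" "det A \<noteq> 0" "q \<noteq> 0"
  shows "quad_grad A q \<noteq> 0"
proof
  assume "quad_grad A q = 0"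
  then have z: "A *v q = 0"
    by (simp add: quad_grad_def vec_eq_iff forall_2 matrix_vector_mult_def sum_2
        symmetric_matrix_nth[OF assms(1), of 2 1])
  have "adj_vec A 0 = q" using adj_vec_surj[OF assms(1,2), of q] unfolding z by simp
  with assms(3) show False by (simp add: adj_vec_def vec_eq_iff forall_2)
qed

text \<open>The complement of the zero section is open and dense, and a dense set stays dense after
  intersection with it. Off the zero section the jet of a metric Hamiltonian is nonzero, as the
  shear argument requires.\<close>

lemma dense_avoiding_zero_section:
  fixes M :: "(real^2) set" and D :: "((real^2) \<times> (real^2)) set"
  assumes "open M" and D: "M \<times> UNIV \<subseteq> closure D"
  shows "M \<times> UNIV \<subseteq> closure {z \<in> D. snd z \<noteq> 0}"
proof -
  let ?O = "M \<times> UNIV :: ((real^2) \<times> (real^2)) set"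
  let ?Z = "UNIV \<times> (- {0}) :: ((real^2) \<times> (real^2)) set"
  have O: "open ?O" using assms(1) by (intro open_Times) auto
  have OZ: "open (?O \<inter> ?Z)" by (rule open_Int[OF O open_Times]) auto
  have "closure ?Z = UNIV"
    by (simp add: closure_Times closure_complement)
  then have "?O \<subseteq> closure (?O \<inter> ?Z)"
    using open_Int_closure_subset[OF O, of ?Z] by simp
  also have "\<dots> \<subseteq> closure (closure {z \<in> D. snd z \<noteq> 0})"
  proof (rule closure_mono)
    have "?O \<inter> ?Z \<subseteq> (?O \<inter> ?Z) \<inter> closure D" using D by blast
    also have "\<dots> \<subseteq> closure ((?O \<inter> ?Z) \<inter> D)" by (rule open_Int_closure_subset[OF OZ])
    also have "\<dots> \<subseteq> closure {z \<in> D. snd z \<noteq> 0}" by (rule closure_mono) auto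
    finally show "?O \<inter> ?Z \<subseteq> closure {z \<in> D. snd z \<noteq> 0}" .
  qed
  finally show ?thesis by simp
qed

text \<open>The condition G sees only q. The map \<Theta> keeps the base point and sends p to the
  covector with the same q with respect to \<eta>; it is continuous and onto over N, so it carries
  dense sets to dense sets.\<close>

lemma dense_change_of_metric:
  assumes "open M" "open N" "N \<subseteq> M" "metric_on M \<psi>" "metric_on N \<eta>"
    and D: "M \<times> UNIV \<subseteq> closure {(x, p). x \<in> M \<and> G x (adj_vec (\<psi> x) p)}"
  shows "N \<times> UNIV \<subseteq> closure {(x, p). x \<in> N \<and> G x (adj_vec (\<eta> x) p)}"
proof clarify
  fix x0 p0 assume x0: "x0 \<in> N"
  let ?N = "N \<times> (UNIV :: (real^2) set)"
  have N: "open ?N" using assms(2) by (intro open_Times) auto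
  have \<psi>: "smooth_on N \<psi>" "\<And>x. x \<in> N \<Longrightarrow> transpose (\<psi> x) = \<psi> x" "\<And>x. x \<in> N \<Longrightarrow> det (\<psi> x) \<noteq> 0"
    using assms(3,4) smooth_on_subset by (auto simp: metric_on_def)
  have \<eta>: "smooth_on N \<eta>" "\<And>x. x \<in> N \<Longrightarrow> transpose (\<eta> x) = \<eta> x" "\<And>x. x \<in> N \<Longrightarrow> det (\<eta> x) \<noteq> 0"
    using assms(5) by (auto simp: metric_on_def)
  define \<Theta> where "\<Theta> z = (fst z, (\<eta> (fst z) *v adj_vec (\<psi> (fst z)) (snd z)) /\<^sub>R det (\<eta> (fst z)))" for z
  define p' where "p' = (\<psi> x0 *v adj_vec (\<eta> x0) p0) /\<^sub>R det (\<psi> x0)"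
  have \<Theta>0: "\<Theta> (x0, p') = (x0, p0)"
    using \<psi>(2,3)[OF x0] \<eta>(2,3)[OF x0] by (simp add: \<Theta>_def p'_def adj_vec_surj mult_adj_vec)
  have lift: "smooth_on ?N (\<lambda>z. f (fst z))" if "smooth_on N f" for f :: "real^2 \<Rightarrow> real"
    using smooth_on_compose_linear[OF bounded_linear_fst assms(2) that]
    by (rule smooth_on_subset) auto
  have sm: "smooth_on ?N \<Theta>"
  proof -
    have e: "\<And>i j. smooth_on ?N (\<lambda>z. \<psi> (fst z) $ i $ j)" "\<And>i j. smooth_on ?N (\<lambda>z. \<eta> (fst z) $ i $ j)"
      "smooth_on ?N (\<lambda>z. inverse (det (\<eta> (fst z))))"
      using lift[OF smooth_on_nth[OF assms(2) smooth_on_nth[OF assms(2) \<psi>(1)]]]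
        lift[OF smooth_on_nth[OF assms(2) smooth_on_nth[OF assms(2) \<eta>(1)]]]
        lift[OF smooth_on_inverse[OF assms(2) smooth_on_det_2[OF assms(2) \<eta>(1)] \<eta>(3)]] by simp_all
    have s: "smooth_on ?N (\<lambda>z. snd z $ i)" for i
      by (rule smooth_on_bounded_linear[OF N bounded_linear_compose[OF bounded_linear_vec_nth bounded_linear_snd]
            smooth_on_ident[OF N]])
    show ?thesis
      unfolding \<Theta>_def[abs_def]
      by (intro smooth_on_Pair smooth_on_vec2I N smooth_on_bounded_linear[OF N bounded_linear_fst smooth_on_ident[OF N]])
         (simp add: matrix_vector_mult_def sum_2 adj_vec_def, intro smooth_on_intros N e s)
  qed
  let ?D = "{(x, p). x \<in> M \<and> G x (adj_vec (\<psi> x) p)}"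
  have "(x0, p') \<in> ?N \<inter> closure ?D" using D x0 assms(3) by blast
  then have "(x0, p') \<in> closure (?N \<inter> ?D)" using open_Int_closure_subset[OF N] by blast
  then obtain X where X: "\<And>n. X n \<in> ?N \<inter> ?D" "X \<longlonglongrightarrow> (x0, p')"
    unfolding closure_sequential by blast
  have "isCont \<Theta> (x0, p')"
    using smooth_on_continuous_on[OF sm] N x0 by (simp add: continuous_on_eq_continuous_at)
  then have "(\<lambda>n. \<Theta> (X n)) \<longlonglongrightarrow> (x0, p0)"
    using isCont_tendsto_compose[OF _ X(2), of \<Theta>] \<Theta>0 by simp
  moreover have "\<Theta> (X n) \<in> {(x, p). x \<in> N \<and> G x (adj_vec (\<eta> x) p)}" for n
    using X(1)[of n] \<eta> by (auto simp: \<Theta>_def adj_vec_surj)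
  ultimately show "(x0, p0) \<in> closure {(x, p). x \<in> N \<and> G x (adj_vec (\<eta> x) p)}"
    unfolding closure_sequential by (intro exI[of _ "\<lambda>n. \<Theta> (X n)"] conjI allI)
qed

lemma generic_shear_dense:
  fixes S :: "'a::{metric_space, second_countable_topology} set" and u v w b :: "'a \<Rightarrow> 'v::real_vector"
  assumes "S \<subseteq> closure {z. z \<in> A \<and> indep3 (u z) (v z) (w z) \<and> b z \<noteq> 0}"
  obtains s :: real where
    "S \<subseteq> closure {z. z \<in> A \<and> indep3 (b z) (v z - s *\<^sub>R u z) (w z - s\<^sup>2 *\<^sub>R u z)}"
proof -
  let ?D = "{z. z \<in> A \<and> indep3 (u z) (v z) (w z) \<and> b z \<noteq> 0}"
  \<comment> \<open>C is taken inside \<open>?D\<close>, not merely in the ambient space, so each of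
    its points satisfies the hypotheses of \<open>finite_dependent_shears\<close>.\<close>
  obtain C where C: "countable C" "C \<subseteq> ?D" "?D \<subseteq> closure C" using separable[of ?D] .
  have "countable (\<Union>z\<in>C. {s. \<not> indep3 (b z) (v z - s *\<^sub>R u z) (w z - s\<^sup>2 *\<^sub>R u z)})"
    using C(2) by (intro countable_UN[OF C(1)] countable_finite[OF finite_dependent_shears]) auto
  then have "(\<Union>z\<in>C. {s. \<not> indep3 (b z) (v z - s *\<^sub>R u z) (w z - s\<^sup>2 *\<^sub>R u z)}) \<noteq> UNIV"
    using uncountable_UNIV_real by metis
  then obtain s where s: "\<And>z. z \<in> C \<Longrightarrow> indep3 (b z) (v z - s *\<^sub>R u z) (w z - s\<^sup>2 *\<^sub>R u z)" by blast
  have "S \<subseteq> closure C" using assms C(3) closure_minimal[OF C(3) closed_closure] by blast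
  also have "\<dots> \<subseteq> closure {z. z \<in> A \<and> indep3 (b z) (v z - s *\<^sub>R u z) (w z - s\<^sup>2 *\<^sub>R u z)}"
    using s C(2) by (intro closure_mono) auto
  finally show thesis by (rule that)
qed

lemma superintegrable_obtain:
  assumes M: "open M" and g: "superintegrable M g V"
    and T: "\<And>x. x \<in> M \<Longrightarrow> killing_eq (T x) (weighted g) x"
    and U: "\<And>x. x \<in> M \<Longrightarrow> potential_eq (U x) (weighted g) V x"
  obtains \<kappa>\<^sub>1 W\<^sub>1 \<kappa>\<^sub>2 W\<^sub>2 where
    "sym_smooth M \<kappa>\<^sub>1" "smooth_on M W\<^sub>1" "\<And>x q. x \<in> M \<Longrightarrow> integral_form (T x) (U x) \<kappa>\<^sub>1 W\<^sub>1 x q = 0"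
    "sym_smooth M \<kappa>\<^sub>2" "smooth_on M W\<^sub>2" "\<And>x q. x \<in> M \<Longrightarrow> integral_form (T x) (U x) \<kappa>\<^sub>2 W\<^sub>2 x q = 0"
    "M \<times> UNIV \<subseteq> closure {(x, p). x \<in> M \<and> jets_indep (weighted g) V \<kappa>\<^sub>1 W\<^sub>1 \<kappa>\<^sub>2 W\<^sub>2 x (adj_vec (weighted g x) p)}"
proof -
  have m: "metric_on M g" and V: "smooth_on M V" using g by (auto simp: superintegrable_def)
  have \<psi>: "metric_on M (weighted g)" by (rule metric_on_weighted[OF M m])
  have g': "g x = weighted g x /\<^sub>R (det (weighted g x))\<^sup>2" if "x \<in> M" for x
    using m that by (intro weighted_inverse) (auto simp: metric_on_def)
  have d: "det (weighted g x) \<noteq> 0" if "x \<in> M" for x using \<psi> that by (auto simp: metric_on_def)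
  obtain K\<^sub>1 W\<^sub>1 K\<^sub>2 W\<^sub>2 where I: "quadratic_integral M (natural_hamiltonian g V) K\<^sub>1 W\<^sub>1"
      "quadratic_integral M (natural_hamiltonian g V) K\<^sub>2 W\<^sub>2"
    and ind: "functionally_independent_on (M \<times> UNIV)
      (natural_hamiltonian g V) (quad_plus_pot K\<^sub>1 W\<^sub>1) (quad_plus_pot K\<^sub>2 W\<^sub>2)"
    using g unfolding superintegrable_def by blast
  have K: "sym_smooth M K\<^sub>1" "smooth_on M W\<^sub>1" "sym_smooth M K\<^sub>2" "smooth_on M W\<^sub>2"
    using I by (auto simp: quadratic_integral_def sym_smooth_def)
  \<comment> \<open>The covariant encoding of K, inverse to K = adj \<psi> \<kappa> adj
    \<psi>.\<close>
  define low where "low K x = (weighted g x ** K x ** weighted g x) /\<^sub>R (det (weighted g x))\<^sup>2" for K x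
  have low: "K x = adj2 (weighted g x) ** low K x ** adj2 (weighted g x)" if "x \<in> M" for K x
    unfolding low_def by (rule adj2_sandwich[OF d[OF that], symmetric])
  have lows: "sym_smooth M (low K)" if "sym_smooth M K" for K
  proof -
    have s: "sym_smooth M (\<lambda>x. weighted g x ** K x ** weighted g x)"
      by (intro sym_smooth_sandwich M sym_smooth_metric_on \<psi> that)
    have "smooth_on M (\<lambda>x. inverse ((det (weighted g x))\<^sup>2))"
      using \<psi> d by (intro smooth_on_inverse smooth_on_power smooth_on_det_2 M) (auto simp: metric_on_def)
    with s show ?thesis
      unfolding sym_smooth_def low_def[abs_def]
      by (auto intro!: smooth_on_scaleR_matrix M simp: transpose_scaleR)
  qed
  note q = quadratic_integral_iff_integral_form[OF M \<psi> V g' T U]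
  show thesis
  proof (rule that[of "low K\<^sub>1" W\<^sub>1 "low K\<^sub>2" W\<^sub>2])
    show "integral_form (T x) (U x) (low K\<^sub>1) W\<^sub>1 x q = 0" if "x \<in> M" for x q
      using q[OF _ _ _ lows[OF K(1)] K(2) low K(1)] I(1) that by simp
    show "integral_form (T x) (U x) (low K\<^sub>2) W\<^sub>2 x q = 0" if "x \<in> M" for x q
      using q[OF _ _ _ lows[OF K(3)] K(4) low K(3)] I(2) that by simp
    show "M \<times> UNIV \<subseteq> closure {(x, p). x \<in> M \<and> jets_indep (weighted g) V (low K\<^sub>1) W\<^sub>1 (low K\<^sub>2) W\<^sub>2 x (adj_vec (weighted g x) p)}"
      using functionally_independent_iff_jets[OF M \<psi> V g' lows[OF K(1)] lows[OF K(3)] K(2,4) low low] ind by simp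
  qed (use K lows in auto)
qed

text \<open>Converse of \<open>superintegrable_obtain\<close>, stated for a given \<psi> with g
  built from it, so that the pencil can be inserted directly as \<psi>.\<close>

lemma superintegrableI_projective:
  assumes N: "open N" and \<psi>: "metric_on N \<psi>" and V: "smooth_on N V"
    and g: "\<And>x. g x = \<psi> x /\<^sub>R (det (\<psi> x))\<^sup>2"
    and T: "\<And>x. x \<in> N \<Longrightarrow> killing_eq (T x) \<psi> x" and U: "\<And>x. x \<in> N \<Longrightarrow> potential_eq (U x) \<psi> V x"
    and \<kappa>\<^sub>1: "sym_smooth N \<kappa>\<^sub>1" "smooth_on N W\<^sub>1" "\<And>x q. x \<in> N \<Longrightarrow> integral_form (T x) (U x) \<kappa>\<^sub>1 W\<^sub>1 x q = 0"
    and \<kappa>\<^sub>2: "sym_smooth N \<kappa>\<^sub>2" "smooth_on N W\<^sub>2" "\<And>x q. x \<in> N \<Longrightarrow> integral_form (T x) (U x) \<kappa>\<^sub>2 W\<^sub>2 x q = 0"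
    and D: "N \<times> UNIV \<subseteq> closure {(x, p). x \<in> N \<and> jets_indep \<psi> V \<kappa>\<^sub>1 W\<^sub>1 \<kappa>\<^sub>2 W\<^sub>2 x (adj_vec (\<psi> x) p)}"
  shows "superintegrable N g V"
  unfolding superintegrable_def
proof (intro conjI exI)
  have \<psi>': "smooth_on N \<psi>" "\<And>x. x \<in> N \<Longrightarrow> transpose (\<psi> x) = \<psi> x" "\<And>x. x \<in> N \<Longrightarrow> det (\<psi> x) \<noteq> 0"
    using \<psi> by (auto simp: metric_on_def)
  show "metric_on N g"
    unfolding metric_on_def
  proof (intro conjI ballI)
    show "smooth_on N g"
      unfolding g[abs_def]
      using \<psi>' by (intro smooth_on_scaleR_matrix smooth_on_inverse smooth_on_power smooth_on_det_2 N) auto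
    show "transpose (g x) = g x" "det (g x) \<noteq> 0" if "x \<in> N" for x
      using \<psi>'(2,3)[OF that] by (simp_all add: g transpose_scaleR det_scaleR_2)
  qed
  define up where "up \<kappa> x = adj2 (\<psi> x) ** \<kappa> x ** adj2 (\<psi> x)" for \<kappa> x
  have ups: "sym_smooth N (up \<kappa>)" if "sym_smooth N \<kappa>" for \<kappa>
    unfolding up_def[abs_def]
    by (intro sym_smooth_sandwich sym_smooth_adj2 sym_smooth_metric_on N \<psi> that)
  note q = quadratic_integral_iff_integral_form[OF N \<psi> V g T U]
  show "quadratic_integral N (natural_hamiltonian g V) (up \<kappa>\<^sub>1) W\<^sub>1"
    using q[OF _ _ \<kappa>\<^sub>1(1,2) up_def ups[OF \<kappa>\<^sub>1(1)]] \<kappa>\<^sub>1(3) by simp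
  show "quadratic_integral N (natural_hamiltonian g V) (up \<kappa>\<^sub>2) W\<^sub>2"
    using q[OF _ _ \<kappa>\<^sub>2(1,2) up_def ups[OF \<kappa>\<^sub>2(1)]] \<kappa>\<^sub>2(3) by simp
  show "functionally_independent_on (N \<times> UNIV) (natural_hamiltonian g V)
      (quad_plus_pot (up \<kappa>\<^sub>1) W\<^sub>1) (quad_plus_pot (up \<kappa>\<^sub>2) W\<^sub>2)"
    using functionally_independent_iff_jets[OF N \<psi> V g \<kappa>\<^sub>1(1) \<kappa>\<^sub>2(1) \<kappa>\<^sub>1(2) \<kappa>\<^sub>2(2),
        of "up \<kappa>\<^sub>1" "up \<kappa>\<^sub>2"] D by (simp add: up_def)
qed (rule V)

theorem theorem2:
  fixes M :: "(real^2) set"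
    and g\<^sub>1 g\<^sub>2 :: "real^2 \<Rightarrow> real^2^2"
    and V\<^sub>1 V\<^sub>2 :: "real^2 \<Rightarrow> real"
    and t :: real
  assumes "open M"
    and "metric_on M g\<^sub>1" and "metric_on M g\<^sub>2"
    and "projectively_equivalent M g\<^sub>1 g\<^sub>2"
    and "lin_indep_metrics M g\<^sub>1 g\<^sub>2"
    and "superintegrable M g\<^sub>1 V\<^sub>1"
    and "superintegrable M g\<^sub>2 V\<^sub>2"
    and "\<forall>x\<in>M. proj_vector_potential g\<^sub>1 V\<^sub>1 x = proj_vector_potential g\<^sub>2 V\<^sub>2 x"
  shows "superintegrable {x\<in>M. det (weighted_pencil g\<^sub>1 g\<^sub>2 t x) \<noteq> 0}
           (metric_family g\<^sub>1 g\<^sub>2 t) (\<lambda>x. V\<^sub>1 x + t * V\<^sub>2 x)"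
proof -
  note M = \<open>open M\<close> and m1 = \<open>metric_on M g\<^sub>1\<close> and m2 = \<open>metric_on M g\<^sub>2\<close>
  let ?\<psi>1 = "weighted g\<^sub>1" and ?\<psi>2 = "weighted g\<^sub>2"
  let ?V = "\<lambda>x. V\<^sub>1 x + t * V\<^sub>2 x"
  define \<eta> where "\<eta> = (\<lambda>x. ?\<psi>1 x + t *\<^sub>R ?\<psi>2 x)"
  have pencil: "weighted_pencil g\<^sub>1 g\<^sub>2 t = \<eta>"
    by (simp add: fun_eq_iff weighted_pencil_def \<eta>_def weighted_def)
  define N where "N = {x\<in>M. det (\<eta> x) \<noteq> 0}"
  define T where "T = thomas g\<^sub>1"
  define U where "U = proj_vector_potential g\<^sub>1 V\<^sub>1"
  have \<psi>m: "metric_on M ?\<psi>1" "metric_on M ?\<psi>2" using metric_on_weighted M m1 m2 by blast+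
  note \<psi>s = \<psi>m[THEN sym_smooth_metric_on]
  have V: "smooth_on M V\<^sub>1" "smooth_on M V\<^sub>2" using assms(6,7) by (auto simp: superintegrable_def)
  have T1: "killing_eq (T x) ?\<psi>1 x" if "x \<in> M" for x
    unfolding T_def by (rule killing_eq_weighted[OF M m1 that])
  \<comment> \<open>The second weighted metric solves the Killing equation for its own Thomas
    symbol, which projective equivalence identifies with that of the first.\<close>
  have T2: "killing_eq (T x) ?\<psi>2 x" if "x \<in> M" for x
    using killing_eq_weighted[OF M m2 that] thomas_projectively_invariant[OF M m1 m2 _ that] assms(4)
    by (simp add: T_def projectively_equivalent_def)
  have U1: "potential_eq (U x) ?\<psi>1 V\<^sub>1 x" if "x \<in> M" for x
    unfolding U_def by (rule potential_eq_weighted[OF m1 that])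
  have U2: "potential_eq (U x) ?\<psi>2 V\<^sub>2 x" if "x \<in> M" for x
    using potential_eq_weighted[OF m2 that] assms(8) that by (simp add: U_def)
  have d: "diff_data ?\<psi>1 x" "diff_data ?\<psi>2 x" "V\<^sub>1 differentiable (at x)" "V\<^sub>2 differentiable (at x)"
    if "x \<in> M" for x
    using \<psi>s V that M by (auto simp: sym_smooth_def intro: smooth_on_diff_data smooth_on_differentiable)
  have \<eta>s: "sym_smooth M \<eta>" unfolding \<eta>_def by (intro sym_smooth_add_scaled M \<psi>s)
  have N: "open N" "N \<subseteq> M"
  proof -
    have "continuous_on M (\<lambda>x. det (\<eta> x))"
      using \<eta>s by (intro smooth_on_continuous_on smooth_on_det_2 M) (auto simp: sym_smooth_def)
    then have "open (M \<inter> (\<lambda>x. det (\<eta> x)) -` (- {0}))"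
      by (intro continuous_open_preimage M) auto
    also have "M \<inter> (\<lambda>x. det (\<eta> x)) -` (- {0}) = N" by (auto simp: N_def)
    finally show "open N" .
  qed (auto simp: N_def)
  have \<eta>m: "metric_on N \<eta>"
    using sym_smooth_subset[OF \<eta>s N(2)] by (auto simp: metric_on_def sym_smooth_def N_def)
  obtain \<kappa>\<^sub>1 W\<^sub>1 \<kappa>\<^sub>2 W\<^sub>2 where
    \<kappa>1: "sym_smooth M \<kappa>\<^sub>1" "smooth_on M W\<^sub>1" "\<And>x q. x \<in> M \<Longrightarrow> integral_form (T x) (U x) \<kappa>\<^sub>1 W\<^sub>1 x q = 0" and
    \<kappa>2: "sym_smooth M \<kappa>\<^sub>2" "smooth_on M W\<^sub>2" "\<And>x q. x \<in> M \<Longrightarrow> integral_form (T x) (U x) \<kappa>\<^sub>2 W\<^sub>2 x q = 0" and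
    D: "M \<times> UNIV \<subseteq> closure {(x, p). x \<in> M \<and> jets_indep ?\<psi>1 V\<^sub>1 \<kappa>\<^sub>1 W\<^sub>1 \<kappa>\<^sub>2 W\<^sub>2 x (adj_vec (?\<psi>1 x) p)}"
    using superintegrable_obtain[OF M assms(6) T1 U1] by blast
  have dk: "diff_data \<kappa>\<^sub>1 x" "diff_data \<kappa>\<^sub>2 x" "W\<^sub>1 differentiable (at x)" "W\<^sub>2 differentiable (at x)"
    if "x \<in> M" for x
    using \<kappa>1 \<kappa>2 that M by (auto simp: sym_smooth_def intro: smooth_on_diff_data smooth_on_differentiable)
  \<comment> \<open>The bracket of a Hamiltonian with itself is zero; through the bracket formula
    this says that \<open>(?\<psi>1, V\<^sub>1)\<close> solves the linear equations for
    integrals.\<close>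
  have self: "integral_form (T x) (U x) ?\<psi>1 V\<^sub>1 x q = 0" if x: "x \<in> M" for x q
  proof -
    have s: "transpose (?\<psi>1 x) = ?\<psi>1 x" "det (?\<psi>1 x) \<noteq> 0" using \<psi>m(1) x by (auto simp: metric_on_def)
    have "poisson_bracket (phase_fun ?\<psi>1 ?\<psi>1 V\<^sub>1) (phase_fun ?\<psi>1 ?\<psi>1 V\<^sub>1) (x, p) = 0" for p
      by (simp add: poisson_bracket_def)
    then show ?thesis
      using poisson_bracket_phase_fun[OF d(1)[OF x] d(1)[OF x] d(3)[OF x] d(3)[OF x] T1[OF x] U1[OF x], of "(?\<psi>1 x *v q) /\<^sub>R det (?\<psi>1 x)"]
        adj_vec_surj[OF s, of q] s(2) by (simp add: det_symmetric_2[OF s(1)])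
  qed
  \<comment> \<open>All jets are taken at q = adj \<eta> p: \<open>?u\<close>, \<open>?v\<close>,
    \<open>?w\<close> come from the first Hamiltonian and its two integrals, \<open>?b\<close> from
    the new Hamiltonian. The names match the roles in \<open>generic_shear_dense\<close>.\<close>
  let ?u = "\<lambda>z. phase_jet ?\<psi>1 V\<^sub>1 (fst z) (adj_vec (\<eta> (fst z)) (snd z))"
  let ?v = "\<lambda>z. phase_jet \<kappa>\<^sub>1 W\<^sub>1 (fst z) (adj_vec (\<eta> (fst z)) (snd z))"
  let ?w = "\<lambda>z. phase_jet \<kappa>\<^sub>2 W\<^sub>2 (fst z) (adj_vec (\<eta> (fst z)) (snd z))"
  let ?b = "\<lambda>z. phase_jet \<eta> ?V (fst z) (adj_vec (\<eta> (fst z)) (snd z))"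
  have "N \<times> UNIV \<subseteq> closure {(x, p). x \<in> N \<and> jets_indep ?\<psi>1 V\<^sub>1 \<kappa>\<^sub>1 W\<^sub>1 \<kappa>\<^sub>2 W\<^sub>2 x (adj_vec (\<eta> x) p)}"
    by (rule dense_change_of_metric[OF M N \<psi>m(1) \<eta>m D])
  then have "N \<times> UNIV \<subseteq> closure {z \<in> {(x, p). x \<in> N \<and> jets_indep ?\<psi>1 V\<^sub>1 \<kappa>\<^sub>1 W\<^sub>1 \<kappa>\<^sub>2 W\<^sub>2 x (adj_vec (\<eta> x) p)}. snd z \<noteq> 0}"
    by (rule dense_avoiding_zero_section[OF N(1)])
  \<comment> \<open>Off the zero section q is nonzero, so the q-gradient of the nondegenerate form
    \<eta> is nonzero, and with it the jet \<open>?b\<close>.\<close>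
  also have "\<dots> \<subseteq> closure {z. z \<in> N \<times> UNIV \<and> indep3 (?u z) (?v z) (?w z) \<and> ?b z \<noteq> 0}"
  proof (rule closure_mono, clarify)
    fix x p assume x: "x \<in> N" and j: "jets_indep ?\<psi>1 V\<^sub>1 \<kappa>\<^sub>1 W\<^sub>1 \<kappa>\<^sub>2 W\<^sub>2 x (adj_vec (\<eta> x) p)" and p: "snd (x, p) \<noteq> 0"
    have s: "transpose (\<eta> x) = \<eta> x" "det (\<eta> x) \<noteq> 0" using \<eta>m x by (auto simp: metric_on_def)
    have "adj_vec (\<eta> x) p \<noteq> 0"
      using mult_adj_vec[OF s(1), of p] s(2) p by auto
    then have "?b (x, p) \<noteq> 0"
      using quad_grad_nonzero[OF s] by (simp add: phase_jet_def prod_eq_iff)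
    with x j show "(x, p) \<in> N \<times> UNIV \<and> indep3 (?u (x, p)) (?v (x, p)) (?w (x, p)) \<and> ?b (x, p) \<noteq> 0"
      by (simp add: jets_indep_def)
  qed
  finally obtain s where s: "N \<times> UNIV \<subseteq> closure {z. z \<in> N \<times> UNIV \<and>
      indep3 (?b z) (?v z - s *\<^sub>R ?u z) (?w z - s\<^sup>2 *\<^sub>R ?u z)}"
    by (rule generic_shear_dense)
  \<comment> \<open>By linearity, subtracting multiples of the solution
    \<open>(?\<psi>1, V\<^sub>1)\<close> yields solutions again, and their jets are the sheared ones
    for which s was chosen.\<close>
  let ?\<mu>1 = "\<lambda>x. \<kappa>\<^sub>1 x + (- s) *\<^sub>R ?\<psi>1 x" and ?L1 = "\<lambda>x. W\<^sub>1 x + (- s) * V\<^sub>1 x"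
  let ?\<mu>2 = "\<lambda>x. \<kappa>\<^sub>2 x + (- s\<^sup>2) *\<^sub>R ?\<psi>1 x" and ?L2 = "\<lambda>x. W\<^sub>2 x + (- s\<^sup>2) * V\<^sub>1 x"
  have "superintegrable N (metric_family g\<^sub>1 g\<^sub>2 t) ?V"
  proof (rule superintegrableI_projective[OF N(1) \<eta>m, of ?V _ T U ?\<mu>1 ?L1 ?\<mu>2 ?L2])
    show "smooth_on N ?V"
      using V by (intro smooth_on_subset[OF _ N(2)] smooth_on_intros M)
    show "metric_family g\<^sub>1 g\<^sub>2 t x = \<eta> x /\<^sub>R (det (\<eta> x))\<^sup>2" for x
      by (simp add: metric_family_def pencil)
    show "killing_eq (T x) \<eta> x" "potential_eq (U x) \<eta> ?V x" if "x \<in> N" for x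
      using that N(2) d T1 T2 U1 U2 unfolding \<eta>_def
      by (auto intro!: killing_eq_add_scaled potential_eq_add_scaled)
    show "sym_smooth N ?\<mu>1" "sym_smooth N ?\<mu>2"
      by (rule sym_smooth_subset[OF sym_smooth_add_scaled[OF M _ \<psi>s(1)] N(2)], rule \<kappa>1 \<kappa>2)+
    show "smooth_on N ?L1" "smooth_on N ?L2"
      by (rule smooth_on_subset[OF smooth_on_add[OF M _ smooth_on_mult[OF M smooth_on_const V(1)]] N(2)],
          rule \<kappa>1 \<kappa>2)+
    show "integral_form (T x) (U x) ?\<mu>1 ?L1 x q = 0" "integral_form (T x) (U x) ?\<mu>2 ?L2 x q = 0"
      if "x \<in> N" for x q
    proof -
      have x: "x \<in> M" using that N(2) by blast
      show "integral_form (T x) (U x) ?\<mu>1 ?L1 x q = 0"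
        unfolding integral_form_add_scaled[OF dk(1)[OF x] d(1)[OF x] dk(3)[OF x] d(3)[OF x]]
        by (simp add: self \<kappa>1(3) x)
      show "integral_form (T x) (U x) ?\<mu>2 ?L2 x q = 0"
        unfolding integral_form_add_scaled[OF dk(2)[OF x] d(1)[OF x] dk(4)[OF x] d(3)[OF x]]
        by (simp add: self \<kappa>2(3) x)
    qed
    have "{z. z \<in> N \<times> UNIV \<and> indep3 (?b z) (?v z - s *\<^sub>R ?u z) (?w z - s\<^sup>2 *\<^sub>R ?u z)}
        = {(x, p). x \<in> N \<and> jets_indep \<eta> ?V ?\<mu>1 ?L1 ?\<mu>2 ?L2 x (adj_vec (\<eta> x) p)}"
    proof -
      have "phase_jet ?\<mu>1 ?L1 x q = phase_jet \<kappa>\<^sub>1 W\<^sub>1 x q - s *\<^sub>R phase_jet ?\<psi>1 V\<^sub>1 x q"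
        "phase_jet ?\<mu>2 ?L2 x q = phase_jet \<kappa>\<^sub>2 W\<^sub>2 x q - s\<^sup>2 *\<^sub>R phase_jet ?\<psi>1 V\<^sub>1 x q" if "x \<in> N" for x q
      proof -
        have x: "x \<in> M" using that N(2) by blast
        show "phase_jet ?\<mu>1 ?L1 x q = phase_jet \<kappa>\<^sub>1 W\<^sub>1 x q - s *\<^sub>R phase_jet ?\<psi>1 V\<^sub>1 x q"
          unfolding phase_jet_add_scaled[OF dk(1)[OF x] d(1)[OF x] dk(3)[OF x] d(3)[OF x]] by simp
        show "phase_jet ?\<mu>2 ?L2 x q = phase_jet \<kappa>\<^sub>2 W\<^sub>2 x q - s\<^sup>2 *\<^sub>R phase_jet ?\<psi>1 V\<^sub>1 x q"
          unfolding phase_jet_add_scaled[OF dk(2)[OF x] d(1)[OF x] dk(4)[OF x] d(3)[OF x]] by simp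
      qed
      then show ?thesis by (auto simp: jets_indep_def)
    qed
    with s show "N \<times> UNIV \<subseteq> closure {(x, p). x \<in> N \<and> jets_indep \<eta> ?V ?\<mu>1 ?L1 ?\<mu>2 ?L2 x (adj_vec (\<eta> x) p)}"
      by simp
  qed
  then show ?thesis by (simp add: pencil N_def)
qed

end
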